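(* Let $t\ge2$ be an integer and set $\mathbf e:=(1,2,\ldots,t)$. The map $\varphi$ (defined in the context) from $SC_{(t+1)}\times DD_{(t+1)}$ to $\mathbb Z^t$ is a bijection such that $\mathbf n=(n_1,\ldots,n_t):=\varphi(\lambda,\mu)$ satisfies $$|\lambda|+|\mu|=(t+1)\|\mathbf n\|^2+\mathbf e\cdot\mathbf n .$$ Besides, for all integers $i\in\{1,\ldots,t\}$, $$t+1+\Delta_i=\sigma_i\left((2t+2)n_i+i\right),$$ where $\sigma_i$ is equal to $1$ if $n_i\ge0$ and to $-1$ if $n_i<0$, and $\Delta_i$ is defined from the principal hook lengths of $(\lambda,\mu)$ as in the context.
   Context: A partition $\lambda=(\lambda_1\ge\dots\ge\lambda_\ell>0)$ has weight $|\lambda|=\sum\lambda_i$; set $\lambda_i=0$ for $i>\ell$; the empty partition is allowed. Its boxes are $(i,j)$ with $1\le i\le\ell$, $1\le j\le\lambda_i$; $\lambda^*$ is the conjugate. The hook length of $(i,j)$ is $\lambda_i-j+\lambda^*_j-i+1$; principal hook lengths are those of boxes $(i,i)$. $D(\lambda)=\#\{i:\lambda_i\ge i\}$. A $(t+1)$-core is a partition with no hook length a multiple of $t+1$. $SC_{(t+1)}$ is the set of self-conjugate ($\lambda=\lambda^*$) $(t+1)$-cores. $DD_{(t+1)}$ is the set of $(t+1)$-cores that are doubled distinct, i.e. satisfy $\mu_i=\mu^*_i+1$ for $1\le i\le D(\mu)$. For a $(t+1)$-core $\nu$, let $\phi(\nu)=(m_0,\ldots,m_t)\in\mathbb Z^{t+1}$,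 where $m_k$ is the greatest integer $r$ such that there is $i\ge1$ with $\nu_i-i\equiv k \bmod (t+1)$ and $(t+1)(r-1)\le\nu_i-i<(t+1)r$. For $\lambda\in SC_{(t+1)}$, $\phi_1(\lambda)$ is the vector of the last $\lfloor (t+1)/2\rfloor$ components of $\phi(\lambda)$ (in order). For $\mu\in DD_{(t+1)}$, $\phi_2(\mu)$ is the vector of the last $\lfloor t/2\rfloor$ components of $\phi(\mu)$ (in order). For $(\lambda,\mu)\in SC_{(t+1)}\times DD_{(t+1)}$ define $\varphi(\lambda,\mu)=(n_1,\ldots,n_t)\in\mathbb Z^t$ by: if $t+1$ is odd, $n_{2i}$ is the $i$-th component of $\phi_1(\lambda)$ and $n_{2i-1}$ is the $i$-th component of $\phi_2(\mu)$; if $t+1$ is even, $n_{2i}$ is the $i$-th component of $\phi_2(\mu)$ and $n_{2i-1}$ is the $i$-th component of $\phi_1(\lambda)$ ($i\ge1$). $\Delta$ is the set of all principal hook lengths of $\lambda$ and of $\mu$ (the former are odd, the latter even), and for $1\le i\le t$, $$\Delta_i:=\max\left(\{h\in\Delta:\ h\equiv\pm i-t-1 \bmod 2t+2\}\cup\{i-t-1\}\right).$$ $\|\cdot\|$ is the Euclidean norm and $\cdot$ the scalar product. *)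

theory Defs
  imports "HOL-Analysis.L2_Norm" "HOL-Library.FuncSet" "HOL-Number_Theory.Cong"
begin

text \<open>A partition is the list of its (positive, weakly decreasing) parts.\<close>

definition is_partition :: "nat list \<Rightarrow> bool" where
  "is_partition \<nu> \<longleftrightarrow> sorted_wrt (\<ge>) \<nu> \<and> (\<forall>x \<in> set \<nu>. x > 0)"

abbreviation weight :: "nat list \<Rightarrow> nat" where
  "weight \<nu> \<equiv> sum_list \<nu>"

text \<open>\<open>comp_at v i\<close> is the \<open>i\<close>-th component of \<open>v\<close>, counted from 1; it is meaningful only for
  \<open>1 \<le> i \<le> length v\<close>.\<close>

definition comp_at :: "'a list \<Rightarrow> nat \<Rightarrow> 'a" where
  "comp_at v i = v ! (i - 1)"

definition part :: "nat list \<Rightarrow> nat \<Rightarrow> nat" where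
  "part \<nu> i = (if 1 \<le> i \<and> i \<le> length \<nu> then comp_at \<nu> i else 0)"

definition boxes :: "nat list \<Rightarrow> (nat \<times> nat) set" where
  "boxes \<nu> = {(i, j). 1 \<le> i \<and> i \<le> length \<nu> \<and> 1 \<le> j \<and> j \<le> part \<nu> i}"

text \<open>The \<open>j\<close>-th part of the conjugate is the number of boxes in column \<open>j\<close>; there are
  \<open>part \<nu> 1\<close> nonempty columns.\<close>

definition conjugate :: "nat list \<Rightarrow> nat list" where
  "conjugate \<nu> = map (\<lambda>j. card {i. (i, j) \<in> boxes \<nu>}) [1..<Suc (part \<nu> 1)]"

definition hook_length :: "nat list \<Rightarrow> nat \<Rightarrow> nat \<Rightarrow> int" where
  "hook_length \<nu> i j = int (part \<nu> i) - int j + int (part (conjugate \<nu>) j) - int i + 1"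

definition principal_hook_lengths :: "nat list \<Rightarrow> int set" where
  "principal_hook_lengths \<nu> = {hook_length \<nu> i i |i. (i, i) \<in> boxes \<nu>}"

definition durfee :: "nat list \<Rightarrow> nat" where
  "durfee \<nu> = card {i. 1 \<le> i \<and> part \<nu> i \<ge> i}"

definition is_core :: "nat \<Rightarrow> nat list \<Rightarrow> bool" where
  "is_core p \<nu> \<longleftrightarrow> is_partition \<nu> \<and> (\<forall>(i, j) \<in> boxes \<nu>. \<not> int p dvd hook_length \<nu> i j)"

definition SC :: "nat \<Rightarrow> nat list set" where
  "SC p = {\<nu>. is_core p \<nu> \<and> conjugate \<nu> = \<nu>}"

definition doubled_distinct :: "nat list \<Rightarrow> bool" where
  "doubled_distinct \<nu> \<longleftrightarrow> (\<forall>i. 1 \<le> i \<and> i \<le> durfee \<nu> \<longrightarrow> part \<nu> i = part (conjugate \<nu>) i + 1)"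

definition DD :: "nat \<Rightarrow> nat list set" where
  "DD p = {\<nu>. is_core p \<nu> \<and> doubled_distinct \<nu>}"

text \<open>\<open>core_vector t \<nu>\<close> is the vector \<open>(m\<^sub>0, \<dots>, m\<^sub>t)\<close> of a \<open>(t + 1)\<close>-core. Here \<open>i\<close> ranges over
  all positive integers, also beyond the length of \<open>\<nu>\<close>, where \<open>part \<nu> i = 0\<close>.\<close>

definition core_vector :: "nat \<Rightarrow> nat list \<Rightarrow> int list" where
  "core_vector t \<nu> = map (\<lambda>k. GREATEST r :: int. \<exists>i \<ge> 1.
       [int (part \<nu> i) - int i = int k] (mod (int t + 1)) \<and>
       (int t + 1) * (r - 1) \<le> int (part \<nu> i) - int i \<and>
       int (part \<nu> i) - int i < (int t + 1) * r) [0..<t + 1]"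

definition last_comps :: "nat \<Rightarrow> 'a list \<Rightarrow> 'a list" where
  "last_comps m v = drop (length v - m) v"

definition phi1 :: "nat \<Rightarrow> nat list \<Rightarrow> int list" where
  "phi1 t lam = last_comps ((t + 1) div 2) (core_vector t lam)"

definition phi2 :: "nat \<Rightarrow> nat list \<Rightarrow> int list" where
  "phi2 t \<mu> = last_comps (t div 2) (core_vector t \<mu>)"

text \<open>Vectors in \<open>\<int>\<^sup>t\<close> are the functions in \<open>{1..t} \<rightarrow>\<^sub>E UNIV\<close>, which take the value
  \<open>undefined\<close> outside \<open>{1..t}\<close>. Below, \<open>j = 2i\<close> gives \<open>i = j div 2\<close> and \<open>j = 2i - 1\<close> gives
  \<open>i = (j + 1) div 2\<close>.\<close>

definition varphi :: "nat \<Rightarrow> nat list \<times> nat list \<Rightarrow> nat \<Rightarrow> int" where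
  "varphi t = (\<lambda>(lam, \<mu>). \<lambda>j \<in> {1..t}.
     if odd (t + 1)
     then (if even j then comp_at (phi1 t lam) (j div 2) else comp_at (phi2 t \<mu>) ((j + 1) div 2))
     else (if even j then comp_at (phi2 t \<mu>) (j div 2) else comp_at (phi1 t lam) ((j + 1) div 2)))"

definition Delta :: "nat list \<Rightarrow> nat list \<Rightarrow> int set" where
  "Delta lam \<mu> = principal_hook_lengths lam \<union> principal_hook_lengths \<mu>"

definition Delta_max :: "nat \<Rightarrow> nat list \<Rightarrow> nat list \<Rightarrow> nat \<Rightarrow> int" where
  "Delta_max t lam \<mu> i = Max
     ({h \<in> Delta lam \<mu>. [h = int i - int t - 1] (mod (2 * int t + 2)) \<or>
                      [h = - int i - int t - 1] (mod (2 * int t + 2))}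
      \<union> {int i - int t - 1})"

end

theory Submission
  imports Defs
begin

text \<open>
  A partition \<open>\<nu>\<close> is encoded by its bead set \<open>{\<nu>\<^sub>i - i | i \<ge> 1}\<close>. The complement of this set is
  \<open>{j - 1 - \<nu>\<^sup>*\<^sub>j | j \<ge> 1}\<close> and hook lengths are differences between a bead and a smaller gap, so \<open>\<nu>\<close> is a
  \<open>p\<close>-core iff its bead set is closed under subtracting \<open>p\<close>, that is, iff it equals
  \<open>{k + p s | 0 \<le> k < p, s < m\<^sub>k}\<close> for some integers \<open>m\<^sub>k\<close>, necessarily of sum \<open>0\<close>. Summing the beads above a
  low multiple of \<open>p\<close> gives \<open>2|\<nu>| = p \<Sum> m\<^sub>k\<^sup>2 + 2 \<Sum> k m\<^sub>k\<close>.

  Self-conjugate cores are those with \<open>m\<close> antisymmetric under \<open>k \<mapsto> t - k\<close>, doubled distinct ones those with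
  \<open>m\<^sub>0 = 0\<close> and \<open>m\<close> antisymmetric under \<open>k \<mapsto> t + 1 - k\<close>. Recentring the indices as \<open>2k - t\<close> and
  \<open>2k - t - 1\<close> merges both vectors into one odd function \<open>N\<close> on \<open>{- t..t}\<close>, of which \<open>\<phi>(\<lambda>, \<mu>)\<close> is the positive
  half. As the \<open>m\<^sub>k\<close> have sum \<open>0\<close>, the weights add up to
  \<open>2(|\<lambda>| + |\<mu>|) = \<Sum>\<^sub>z ((t + 1) N(z)\<^sup>2 + z N(z))\<close> over \<open>|z| \<le> t\<close>.
\<close>

subsection \<open>Parts and conjugates\<close>

lemma part_Nil [simp]: "part [] i = 0"
  by (simp add: part_def)

lemma part_Cons_Suc [simp]: "part (a # \<nu>) (Suc i) = (if i = 0 then a else part \<nu> i)"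
  by (auto simp: part_def comp_at_def nth_Cons')

lemma part_Suc: "i < length \<nu> \<Longrightarrow> part \<nu> (Suc i) = \<nu> ! i"
  by (simp add: part_def comp_at_def)

lemma part_beyond: "length \<nu> < i \<Longrightarrow> part \<nu> i = 0"
  by (simp add: part_def)

lemma part_pos_iff: "is_partition \<nu> \<Longrightarrow> 0 < part \<nu> i \<longleftrightarrow> 1 \<le> i \<and> i \<le> length \<nu>"
  by (auto simp: part_def comp_at_def is_partition_def)

lemma part_antimono:
  assumes "is_partition \<nu>" "1 \<le> i" "i \<le> j"
  shows "part \<nu> j \<le> part \<nu> i"
proof (cases "i = j \<or> length \<nu> < j")
  case False
  then have "i - 1 < j - 1" "j - 1 < length \<nu>" using assms by auto
  with assms False show ?thesis
    by (simp add: part_def comp_at_def is_partition_def sorted_wrt_iff_nth_less)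
qed (auto simp: part_beyond)

lemma partition_eqI:
  assumes "is_partition \<nu>" "is_partition \<mu>" and eq: "\<And>i. 1 \<le> i \<Longrightarrow> part \<nu> i = part \<mu> i"
  shows "\<nu> = \<mu>"
proof (rule nth_equalityI)
  have "\<And>i. 1 \<le> i \<Longrightarrow> i \<le> length \<nu> \<longleftrightarrow> i \<le> length \<mu>"
    using part_pos_iff[OF assms(1)] part_pos_iff[OF assms(2)] eq by metis
  from this[of "length \<nu>"] this[of "length \<mu>"] this[of 1] show len: "length \<nu> = length \<mu>"
    by (cases "length \<nu> = 0"; cases "length \<mu> = 0") auto
  fix i assume "i < length \<nu>"
  then show "\<nu> ! i = \<mu> ! i" using eq[of "Suc i"] len by (simp add: part_Suc)
qed

lemma sum_part: "length \<nu> \<le> N \<Longrightarrow> (\<Sum>i = 1..N. part \<nu> i) = weight \<nu>"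
proof (induction \<nu> arbitrary: N)
  case (Cons a \<nu>)
  then obtain M where N: "N = Suc M" and M: "length \<nu> \<le> M" by (cases N) auto
  have "(\<Sum>i = 1..N. part (a # \<nu>) i) = (\<Sum>i = 0..M. part (a # \<nu>) (Suc i))"
    unfolding N by (metis One_nat_def sum.shift_bounds_cl_Suc_ivl)
  also have "\<dots> = a + (\<Sum>i = 1..M. part \<nu> i)"
    by (simp add: sum.atLeast_Suc_atMost)
  finally show ?case using Cons.IH[OF M] by simp
qed simp

lemma mem_boxes_iff: "(i, j) \<in> boxes \<nu> \<longleftrightarrow> 1 \<le> i \<and> 1 \<le> j \<and> j \<le> part \<nu> i"
  by (auto simp: boxes_def part_def)

lemma length_conjugate: "length (conjugate \<nu>) = part \<nu> 1"
  by (simp add: conjugate_def)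

lemma part_conjugate:
  assumes "is_partition \<nu>" "1 \<le> j"
  shows "part (conjugate \<nu>) j = card {i. 1 \<le> i \<and> j \<le> part \<nu> i}"
proof (cases "j \<le> part \<nu> 1")
  case True
  have "[1..<Suc (part \<nu> 1)] ! (j - 1) = j"
    using True assms by (subst nth_upt) auto
  then have "conjugate \<nu> ! (j - 1) = card {i. (i, j) \<in> boxes \<nu>}"
    using True assms by (simp add: conjugate_def del: upt_Suc)
  then show ?thesis
    using True assms by (simp add: part_def[of "conjugate \<nu>"] comp_at_def length_conjugate mem_boxes_iff)
next
  case False
  then have "\<And>i. 1 \<le> i \<Longrightarrow> \<not> j \<le> part \<nu> i"
    using part_antimono[OF assms(1) order_refl] order_trans by blast
  then have "{i. 1 \<le> i \<and> j \<le> part \<nu> i} = {}" by blast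
  with False show ?thesis by (simp only: part_beyond length_conjugate not_le card.empty)
qed

text \<open>Parts decrease, so the rows with at least \<open>j\<close> boxes form an initial segment
  \<open>{1..c}\<close>, and \<open>c\<close> is the \<open>j\<close>-th part of the
  conjugate.\<close>

lemma le_part_conjugate_iff:
  assumes "is_partition \<nu>" "1 \<le> i" "1 \<le> j"
  shows "i \<le> part (conjugate \<nu>) j \<longleftrightarrow> j \<le> part \<nu> i"
proof -
  define S where "S = {i. 1 \<le> i \<and> j \<le> part \<nu> i}"
  have "i \<le> length \<nu>" if "i \<in> S" for i
    using that assms part_pos_iff[OF assms(1), of i] unfolding S_def by auto
  then have fin: "finite S" by (meson finite_nat_set_iff_bounded_le)
  have "i \<le> card S \<longleftrightarrow> j \<le> part \<nu> i"
  proof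
    assume "j \<le> part \<nu> i"
    then have "{1..i} \<subseteq> S"
      unfolding S_def using part_antimono[OF assms(1)] order_trans by fastforce
    from card_mono[OF fin this] show "i \<le> card S" by simp
  next
    assume le: "i \<le> card S"
    show "j \<le> part \<nu> i"
    proof (rule ccontr)
      assume "\<not> j \<le> part \<nu> i"
      then have "j' < i" if "j' \<in> S" for j'
        using part_antimono[OF assms(1,2), of j'] that by (fastforce simp: S_def not_less[symmetric])
      then have "S \<subseteq> {1..<i}" by (auto simp: S_def)
      from card_mono[OF _ this] have "card S \<le> i - 1" by simp
      with le assms show False by simp
    qed
  qed
  then show ?thesis using part_conjugate[OF assms(1,3)] by (simp add: S_def)
qed

lemma is_partition_conjugate:
  assumes "is_partition \<nu>"
  shows "is_partition (conjugate \<nu>)"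
proof -
  have anti: "part (conjugate \<nu>) j \<le> part (conjugate \<nu>) i" if "1 \<le> i" "i \<le> j" for i j
  proof (cases "part (conjugate \<nu>) j = 0")
    case False
    then show ?thesis
      using le_part_conjugate_iff[OF assms, of "part (conjugate \<nu>) j" j]
        le_part_conjugate_iff[OF assms, of "part (conjugate \<nu>) j" i] that by simp
  qed simp
  have "1 \<le> part (conjugate \<nu>) j" if "1 \<le> j" "j \<le> length (conjugate \<nu>)" for j
    using le_part_conjugate_iff[OF assms, of 1 j] that by (simp add: length_conjugate)
  then have "0 < conjugate \<nu> ! k" if "k < length (conjugate \<nu>)" for k
    using that by (simp add: Suc_le_eq flip: part_Suc)
  moreover have "conjugate \<nu> ! l \<le> conjugate \<nu> ! k" if "k < l" "l < length (conjugate \<nu>)" for k l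
    using anti[of "Suc k" "Suc l"] that by (simp add: part_Suc)
  ultimately show ?thesis
    by (auto simp: is_partition_def sorted_wrt_iff_nth_less in_set_conv_nth)
qed

subsection \<open>Bead sets\<close>

text \<open>The index runs over all positive integers, so the zero parts past the end contribute
  every integer below \<open>- length \<nu>\<close>. This is the Maya diagram of charge zero, or
  infinite beta-set, of the partition.\<close>

definition beads :: "nat list \<Rightarrow> int set" where
  "beads \<nu> = (\<lambda>i. int (part \<nu> i) - int i) ` {1..}"

lemma mem_beads_iff: "x \<in> beads \<nu> \<longleftrightarrow> (\<exists>i \<ge> 1. int (part \<nu> i) - int i = x)"
  by (auto simp: beads_def)

lemma bead_strict_antimono:
  assumes "is_partition \<nu>" "1 \<le> i" "i < j"
  shows "int (part \<nu> j) - int j < int (part \<nu> i) - int i"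
  using part_antimono[of \<nu> i j] assms by simp

lemma bead_inj_on: "is_partition \<nu> \<Longrightarrow> inj_on (\<lambda>i. int (part \<nu> i) - int i) {1..}"
  by (rule linorder_inj_onI) (use bead_strict_antimono in fastforce)+

text \<open>If the box \<open>(i, j)\<close> lies in the diagram, the lengths of row
  \<open>i\<close> and column \<open>j\<close> add up to at least \<open>i + j\<close>, otherwise to
  at most \<open>i + j - 2\<close>. A coincidence with the bead of row \<open>i\<close> would
  require the sum \<open>i + j - 1\<close>.\<close>

lemma gap_conjugate:
  assumes "is_partition \<nu>" "1 \<le> j"
  shows "int j - 1 - int (part (conjugate \<nu>) j) \<notin> beads \<nu>"
proof
  assume "int j - 1 - int (part (conjugate \<nu>) j) \<in> beads \<nu>"
  then obtain i where i: "1 \<le> i" "int (part \<nu> i) - int i = int j - 1 - int (part (conjugate \<nu>) j)"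
    by (auto simp: beads_def)
  with le_part_conjugate_iff[OF assms(1) i(1) assms(2)] show False by linarith
qed

text \<open>Let \<open>i\<close> be the first row whose bead lies below \<open>y\<close>. The gap
  \<open>y\<close> sits strictly between the beads of rows \<open>i - 1\<close> and \<open>i\<close>
  (or above all beads if \<open>i = 1\<close>), so column \<open>j = y + i\<close> has exactly
  \<open>i - 1\<close> boxes.\<close>

lemma obtain_gap_index:
  assumes "is_partition \<nu>" "y \<notin> beads \<nu>"
  obtains j where "1 \<le> j" "y = int j - 1 - int (part (conjugate \<nu>) j)"
proof -
  define i where "i = (LEAST i. 1 \<le> i \<and> int (part \<nu> i) - int i < y)"
  have ex: "\<exists>i. 1 \<le> i \<and> int (part \<nu> i) - int i < y"
    by (rule exI[of _ "nat (1 + \<bar>y\<bar>) + length \<nu>"]) (auto simp: part_beyond)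
  have i: "1 \<le> i" "int (part \<nu> i) - int i < y"
    using LeastI_ex[OF ex] by (auto simp: i_def)
  define j where "j = nat (y + int i)"
  have j: "int j = y + int i" "1 \<le> j" "\<not> j \<le> part \<nu> i" using i by (auto simp: j_def)
  have "part (conjugate \<nu>) j = i - 1"
  proof (cases "i = 1")
    case True
    then show ?thesis using le_part_conjugate_iff[OF assms(1) i(1) j(2)] j by simp
  next
    case False
    then have "1 \<le> i - 1" using i by simp
    then have "i - 1 < i" by simp
    then have "\<not> int (part \<nu> (i - 1)) - int (i - 1) < y"
      unfolding i_def using not_less_Least \<open>1 \<le> i - 1\<close> unfolding i_def by blast
    moreover have "int (part \<nu> (i - 1)) - int (i - 1) \<noteq> y"
      using assms(2) imageI[of "i - 1" "{1..}" "\<lambda>i. int (part \<nu> i) - int i"] \<open>1 \<le> i - 1\<close>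
      unfolding beads_def by (metis atLeast_iff)
    ultimately have "j \<le> part \<nu> (i - 1)" using j \<open>1 \<le> i - 1\<close> by linarith
    then show ?thesis
      using le_part_conjugate_iff[OF assms(1) i(1) j(2)] j
        le_part_conjugate_iff[OF assms(1) \<open>1 \<le> i - 1\<close> j(2)] by simp
  qed
  then show thesis using that[of j] j i by simp
qed

lemma beads_conjugate:
  assumes "is_partition \<nu>"
  shows "x \<in> beads (conjugate \<nu>) \<longleftrightarrow> - 1 - x \<notin> beads \<nu>"
proof
  assume "x \<in> beads (conjugate \<nu>)"
  then obtain j where "1 \<le> j" "x = int (part (conjugate \<nu>) j) - int j" by (auto simp: beads_def)
  with gap_conjugate[OF assms, of j] show "- 1 - x \<notin> beads \<nu>"
    by (simp add: diff_diff_eq2 diff_diff_eq)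
next
  assume "- 1 - x \<notin> beads \<nu>"
  then obtain j where "1 \<le> j" "- 1 - x = int j - 1 - int (part (conjugate \<nu>) j)"
    by (rule obtain_gap_index[OF assms])
  then show "x \<in> beads (conjugate \<nu>)" by (auto simp: beads_def intro!: image_eqI[of _ _ j])
qed

text \<open>The hook length of \<open>(i, j)\<close> is the \<open>i\<close>-th bead minus the
  \<open>j\<close>-th gap, and \<open>(i, j)\<close> is a box exactly when this difference is
  positive.\<close>

lemma hook_lengths_eq:
  assumes "is_partition \<nu>"
  shows "{hook_length \<nu> i j |i j. (i, j) \<in> boxes \<nu>} = {x - y |x y. x \<in> beads \<nu> \<and> y \<notin> beads \<nu> \<and> y < x}"
proof (intro set_eqI iffI)
  fix h assume "h \<in> {hook_length \<nu> i j |i j. (i, j) \<in> boxes \<nu>}"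
  then obtain i j where h: "h = hook_length \<nu> i j" and ij: "1 \<le> i" "1 \<le> j" "j \<le> part \<nu> i"
    by (auto simp: mem_boxes_iff)
  let ?x = "int (part \<nu> i) - int i" and ?y = "int j - 1 - int (part (conjugate \<nu>) j)"
  have "?x \<in> beads \<nu>" using ij by (auto simp: beads_def)
  moreover have "?y \<notin> beads \<nu>" by (rule gap_conjugate[OF assms ij(2)])
  moreover have "?y < ?x" using le_part_conjugate_iff[OF assms ij(1,2)] ij by simp
  moreover have "h = ?x - ?y" by (simp add: h hook_length_def)
  ultimately show "h \<in> {x - y |x y. x \<in> beads \<nu> \<and> y \<notin> beads \<nu> \<and> y < x}" by blast
next
  fix h assume "h \<in> {x - y |x y. x \<in> beads \<nu> \<and> y \<notin> beads \<nu> \<and> y < x}"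
  then obtain x y where h: "h = x - y" and x: "x \<in> beads \<nu>" and y: "y \<notin> beads \<nu>" and "y < x" by auto
  obtain i where i: "1 \<le> i" "x = int (part \<nu> i) - int i" using x by (auto simp: beads_def)
  obtain j where j: "1 \<le> j" "y = int j - 1 - int (part (conjugate \<nu>) j)"
    by (rule obtain_gap_index[OF assms y])
  have "j \<le> part \<nu> i"
    using le_part_conjugate_iff[OF assms i(1) j(1)] \<open>y < x\<close> i j by linarith
  then show "h \<in> {hook_length \<nu> i j |i j. (i, j) \<in> boxes \<nu>}"
    using h i j by (simp add: mem_boxes_iff hook_length_def) (intro exI[of _ i] exI[of _ j], simp)
qed

lemma is_core_iff_beads:
  assumes "is_partition \<nu>" "0 < p"
  shows "is_core p \<nu> \<longleftrightarrow> (\<forall>x \<in> beads \<nu>. x - int p \<in> beads \<nu>)"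
proof -
  have "is_core p \<nu> \<longleftrightarrow> (\<forall>h \<in> {hook_length \<nu> i j |i j. (i, j) \<in> boxes \<nu>}. \<not> int p dvd h)"
    using assms(1) by (auto simp: is_core_def)
  also have "\<dots> \<longleftrightarrow> (\<forall>x y. x \<in> beads \<nu> \<and> y \<notin> beads \<nu> \<and> y < x \<longrightarrow> \<not> int p dvd x - y)"
    unfolding hook_lengths_eq[OF assms(1)] by blast
  also have "\<dots> \<longleftrightarrow> (\<forall>x \<in> beads \<nu>. x - int p \<in> beads \<nu>)"
  proof
    assume *: "\<forall>x y. x \<in> beads \<nu> \<and> y \<notin> beads \<nu> \<and> y < x \<longrightarrow> \<not> int p dvd x - y"
    show "\<forall>x \<in> beads \<nu>. x - int p \<in> beads \<nu>"
      using *[rule_format, of _ "_ - int p"] assms(2) by fastforce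
  next
    assume closed: "\<forall>x \<in> beads \<nu>. x - int p \<in> beads \<nu>"
    have down: "x - int p * int n \<in> beads \<nu>" if "x \<in> beads \<nu>" for x n
    proof (induction n)
      case (Suc n)
      from bspec[OF closed this] show ?case by (simp add: algebra_simps)
    qed (use that in simp)
    show "\<forall>x y. x \<in> beads \<nu> \<and> y \<notin> beads \<nu> \<and> y < x \<longrightarrow> \<not> int p dvd x - y"
    proof (intro allI impI notI)
      fix x y assume *: "x \<in> beads \<nu> \<and> y \<notin> beads \<nu> \<and> y < x" and "int p dvd x - y"
      then obtain c where c: "x - y = int p * c" by (auto elim: dvdE)
      with * assms(2) have "0 < int p * c" by simp
      then have "0 \<le> c" using assms(2) by (simp add: zero_less_mult_iff)
      with down[of x "nat c"] * c show False by (simp add: algebra_simps)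
    qed
  qed
  finally show ?thesis .
qed

text \<open>A finite set has only one decreasing enumeration; negation turns it into the strictly
  increasing one. This lets equalities of sequences of beads be replaced by equalities of
  sets.\<close>

lemma strict_antimono_image_unique:
  fixes f g :: "nat \<Rightarrow> int"
  assumes f: "\<And>i j. 1 \<le> i \<Longrightarrow> i < j \<Longrightarrow> j \<le> N \<Longrightarrow> f j < f i"
    and g: "\<And>i j. 1 \<le> i \<Longrightarrow> i < j \<Longrightarrow> j \<le> N \<Longrightarrow> g j < g i"
    and im: "f ` {1..N} = g ` {1..N}" and i: "1 \<le> i" "i \<le> N"
  shows "f i = g i"
proof -
  have "map (\<lambda>i. - f i) [1..<Suc N] = map (\<lambda>i. - g i) [1..<Suc N]"
  proof (rule strict_sorted_equal)
    show "sorted_wrt (<) (map (\<lambda>i. - f i) [1..<Suc N])"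
      by (auto simp: sorted_wrt_iff_nth_less simp del: upt_Suc intro!: f)
    show "sorted_wrt (<) (map (\<lambda>i. - g i) [1..<Suc N])"
      by (auto simp: sorted_wrt_iff_nth_less simp del: upt_Suc intro!: g)
    have "uminus ` f ` {1..N} = uminus ` g ` {1..N}" by (simp only: im)
    then show "set (map (\<lambda>i. - f i) [1..<Suc N]) = set (map (\<lambda>i. - g i) [1..<Suc N])"
      by (simp add: image_image atLeastLessThanSuc_atLeastAtMost del: upt_Suc)
  qed
  then have "\<forall>i \<in> set [1..<Suc N]. - f i = - g i" by (simp only: map_eq_conv)
  with i show ?thesis by auto
qed

text \<open>Cutting at \<open>- int N\<close> below all nonzero rows makes the bead set finite:
  exactly the beads of the first \<open>N\<close> rows survive, so they can be counted and
  summed.\<close>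

lemma beads_above:
  assumes "length \<nu> \<le> N"
  shows "beads \<nu> \<inter> {- int N..} = (\<lambda>i. int (part \<nu> i) - int i) ` {1..N}"
proof -
  have "i \<le> N" if "- int N \<le> int (part \<nu> i) - int i" for i
    using that assms by (cases "i \<le> length \<nu>") (auto simp: part_beyond)
  then show ?thesis by (auto simp: beads_def)
qed

lemma beads_below:
  assumes "length \<nu> \<le> N" "x < - int N"
  shows "x \<in> beads \<nu>"
  using assms by (auto simp: beads_def part_beyond intro!: image_eqI[of _ _ "nat (- x)"])

lemma beads_inject:
  assumes "is_partition \<nu>" "is_partition \<mu>" "beads \<nu> = beads \<mu>"
  shows "\<nu> = \<mu>"
proof (rule partition_eqI[OF assms(1,2)])
  fix i :: nat assume "1 \<le> i"
  let ?N = "max i (max (length \<nu>) (length \<mu>))"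
  have "(\<lambda>i. int (part \<nu> i) - int i) ` {1..?N} = (\<lambda>i. int (part \<mu> i) - int i) ` {1..?N}"
    using beads_above[of \<nu> ?N] beads_above[of \<mu> ?N] assms(3) by simp
  from strict_antimono_image_unique[OF _ _ this, of i]
  have "int (part \<nu> i) - int i = int (part \<mu> i) - int i"
    using bead_strict_antimono[OF assms(1)] bead_strict_antimono[OF assms(2)] \<open>1 \<le> i\<close> by simp
  then show "part \<nu> i = part \<mu> i" by simp
qed

section \<open>Self-conjugate and doubled distinct partitions as symmetric bead sets\<close>

lemma self_conjugate_iff_beads:
  assumes "is_partition \<nu>"
  shows "conjugate \<nu> = \<nu> \<longleftrightarrow> (\<forall>x. x \<in> beads \<nu> \<longleftrightarrow> - 1 - x \<notin> beads \<nu>)"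
proof -
  have "conjugate \<nu> = \<nu> \<longleftrightarrow> beads (conjugate \<nu>) = beads \<nu>"
    using beads_inject[OF is_partition_conjugate[OF assms] assms] by auto
  then show ?thesis by (auto simp: set_eq_iff beads_conjugate[OF assms])
qed

lemma durfee_iff:
  assumes "is_partition \<nu>" "1 \<le> i"
  shows "i \<le> durfee \<nu> \<longleftrightarrow> i \<le> part \<nu> i"
proof -
  define S where "S = {i. 1 \<le> i \<and> i \<le> part \<nu> i}"
  have "i \<le> length \<nu>" if "i \<in> S" for i
    using that part_pos_iff[OF assms(1), of i] unfolding S_def by auto
  then have fin: "finite S" by (meson finite_nat_set_iff_bounded_le)
  have "i \<le> card S" if "i \<le> part \<nu> i"
  proof -
    have "{1..i} \<subseteq> S" unfolding S_def using part_antimono[OF assms(1)] that by fastforce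
    from card_mono[OF fin this] show ?thesis by simp
  qed
  moreover have "card S < i" if "\<not> i \<le> part \<nu> i"
  proof -
    have "j < i" if "j \<in> S" for j
    proof (rule ccontr)
      assume "\<not> j < i"
      with part_antimono[OF assms, of j] that \<open>\<not> i \<le> part \<nu> i\<close> show False by (simp add: S_def)
    qed
    then have "S \<subseteq> {1..<i}" by (auto simp: S_def)
    from card_mono[OF _ this] have "card S \<le> i - 1" by simp
    with assms show ?thesis by simp
  qed
  ultimately show ?thesis unfolding durfee_def S_def by fastforce
qed

lemma nonneg_beads:
  assumes "is_partition \<nu>"
  shows "(\<lambda>i. int (part \<nu> i) - int i) ` {1..durfee \<nu>} = {x \<in> beads \<nu>. 0 \<le> x}"
  using durfee_iff[OF assms] by (fastforce simp: beads_def)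

lemma durfee_conjugate: 
  assumes "is_partition \<nu>"
  shows "durfee (conjugate \<nu>) = durfee \<nu>"
proof -
  have "{i. 1 \<le> i \<and> i \<le> part (conjugate \<nu>) i} = {i. 1 \<le> i \<and> i \<le> part \<nu> i}"
    using le_part_conjugate_iff[OF assms] by auto
  then show ?thesis by (simp add: durfee_def)
qed

text \<open>The condition equates the nonnegative beads of \<open>\<nu>\<close>, in order, with
  those of the conjugate raised by 1. Both sequences decrease strictly, so it is an equality of
  sets, and the raised beads are the \<open>x \<ge> 1\<close> for which \<open>- x\<close> is a gap.
  As 0 can occur only on the left, it must be a gap; negative \<open>x\<close> follow by exchanging
  \<open>x\<close> and \<open>- x\<close>.\<close>

lemma doubled_distinct_iff_beads:
  assumes "is_partition \<nu>"
  shows "doubled_distinct \<nu> \<longleftrightarrow> 0 \<notin> beads \<nu> \<and> (\<forall>x. x \<noteq> 0 \<longrightarrow> (x \<in> beads \<nu> \<longleftrightarrow> - x \<notin> beads \<nu>))"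
    (is "_ \<longleftrightarrow> ?R")
proof -
  let ?c = "conjugate \<nu>"
  note conj = is_partition_conjugate[OF assms]
  let ?f = "\<lambda>i. int (part \<nu> i) - int i" and ?g = "\<lambda>i. int (part ?c i) - int i + 1"
  have img: "?g ` {1..durfee \<nu>} = {x. 1 \<le> x \<and> - x \<notin> beads \<nu>}" (is "_ = ?B")
  proof -
    have "?g ` {1..durfee \<nu>} = (\<lambda>x. x + 1) ` {x \<in> beads ?c. 0 \<le> x}"
      unfolding nonneg_beads[OF conj, symmetric] durfee_conjugate[OF assms] by (simp add: image_image)
    also have "\<dots> = ?B"
    proof (intro set_eqI)
      fix x
      have "x \<in> (\<lambda>x. x + 1) ` {x \<in> beads ?c. 0 \<le> x} \<longleftrightarrow> x - 1 \<in> {x \<in> beads ?c. 0 \<le> x}"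
        by (auto intro!: image_eqI[of _ _ "x - 1"])
      also have "\<dots> \<longleftrightarrow> x \<in> ?B" by (auto simp: beads_conjugate[OF assms])
      finally show "x \<in> (\<lambda>x. x + 1) ` {x \<in> beads ?c. 0 \<le> x} \<longleftrightarrow> x \<in> ?B" .
    qed
    finally show ?thesis .
  qed
  have "doubled_distinct \<nu> \<longleftrightarrow> (\<forall>i \<in> {1..durfee \<nu>}. ?f i = ?g i)"
    by (auto simp: doubled_distinct_def algebra_simps simp flip: of_nat_Suc)
  also have "\<dots> \<longleftrightarrow> ?f ` {1..durfee \<nu>} = ?g ` {1..durfee \<nu>}"
  proof
    assume im: "?f ` {1..durfee \<nu>} = ?g ` {1..durfee \<nu>}"
    have f: "?f j < ?f i" and g: "?g j < ?g i" if "1 \<le> i" "i < j" for i j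
      using bead_strict_antimono[OF assms that] bead_strict_antimono[OF conj that] by linarith+
    show "\<forall>i \<in> {1..durfee \<nu>}. ?f i = ?g i"
    proof
      fix i assume "i \<in> {1..durfee \<nu>}"
      then show "?f i = ?g i"
        using strict_antimono_image_unique[OF f g im, of i] by simp
    qed
  qed (auto intro: image_cong)
  also have "\<dots> \<longleftrightarrow> {x \<in> beads \<nu>. 0 \<le> x} = ?B"
    by (simp only: nonneg_beads[OF assms] img)
  also have "\<dots> \<longleftrightarrow> ?R"
  proof
    assume eq: "{x \<in> beads \<nu>. 0 \<le> x} = ?B"
    have "0 \<notin> beads \<nu>" using eq by force
    moreover have "x \<in> beads \<nu> \<longleftrightarrow> - x \<notin> beads \<nu>" if "x \<noteq> 0" for x
    proof (cases "0 < x")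
      case True
      then show ?thesis using eq[unfolded set_eq_iff, rule_format, of x] by simp
    next
      case False
      then show ?thesis using eq[unfolded set_eq_iff, rule_format, of "- x"] that by auto
    qed
    ultimately show ?R by blast
  next
    assume R: ?R
    show "{x \<in> beads \<nu>. 0 \<le> x} = ?B"
    proof (intro set_eqI)
      fix x
      show "x \<in> {x \<in> beads \<nu>. 0 \<le> x} \<longleftrightarrow> x \<in> ?B"
      proof (cases "0 < x")
        case True
        then show ?thesis using R[THEN conjunct2, rule_format, of x] by simp
      next
        case False
        then show ?thesis using R[THEN conjunct1] by (cases "x = 0") auto
      qed
    qed
  qed
  finally show ?thesis .
qed

section \<open>Which sets are bead sets, and the count and sum of truncated bead sets\<close>

text \<open>The largest element \<open>x\<close> is the bead of row 1, whose part is
  \<open>x + 1\<close>. The remaining elements become beads of rows numbered one less, hence are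
  raised by 1 before the induction hypothesis is applied.\<close>

lemma finite_beads_realised:
  assumes "finite S" "card S = N" "S \<subseteq> {- int N..}"
  shows "\<exists>\<nu>. is_partition \<nu> \<and> length \<nu> \<le> N \<and> (\<lambda>i. int (part \<nu> i) - int i) ` {1..N} = S"
  using assms
proof (induction N arbitrary: S)
  case 0
  then show ?case by (auto simp: is_partition_def intro!: exI[of _ "[]"])
next
  case (Suc N)
  define x where "x = Max S"
  have "S \<noteq> {}" using Suc.prems by auto
  then have x: "x \<in> S" "\<And>y. y \<in> S \<Longrightarrow> y \<le> x" using Suc.prems by (auto simp: x_def)
  define S' where "S' = (\<lambda>y. y + 1) ` (S - {x})"
  have "card S' = N"
    using Suc.prems x by (simp add: S'_def card_image)
  moreover have "S' \<subseteq> {- int N..}" using Suc.prems(3) by (auto simp: S'_def)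
  ultimately obtain \<nu> where \<nu>: "is_partition \<nu>" "length \<nu> \<le> N"
      "(\<lambda>i. int (part \<nu> i) - int i) ` {1..N} = S'"
    using Suc.IH[of S'] Suc.prems(1) by (auto simp: S'_def)
  \<comment> \<open>The interval has \<open>x + N + 2\<close> elements and must hold the
    \<open>N + 1\<close> elements of \<open>S\<close>.\<close>
  have "S \<subseteq> {- int (Suc N)..x}" using Suc.prems(3) x(2) by auto
  from card_mono[OF _ this] have "- 1 \<le> x" using Suc.prems(2) by simp
  have top: "int (part \<nu> 1) \<le> x + 1"
  proof (cases "N = 0")
    case True
    then show ?thesis using \<nu>(2) \<open>- 1 \<le> x\<close> by (simp add: part_beyond)
  next
    case False
    then have "int (part \<nu> 1) - int 1 \<in> S'" unfolding \<nu>(3)[symmetric] by (intro imageI) simp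
    then have "int (part \<nu> 1) - 2 \<in> S" by (auto simp: S'_def)
    from x(2)[OF this] show ?thesis
      using \<open>int (part \<nu> 1) - int 1 \<in> S'\<close> by (fastforce simp: S'_def)
  qed
  \<comment> \<open>For \<open>x = - 1\<close> the first part would be 0, which a list of positive
    parts cannot contain; then \<open>\<nu>\<close> is empty and so is \<open>\<mu>\<close>.\<close>
  define \<mu> where "\<mu> = (if x = - 1 then \<nu> else nat (x + 1) # \<nu>)"
  have nil: "\<nu> = []" if "x = - 1"
    using top that part_pos_iff[OF \<nu>(1), of 1] by (cases \<nu>) auto
  have le: "a \<le> part \<nu> 1" if a: "a \<in> set \<nu>" for a
  proof -
    obtain i where "i < length \<nu>" "a = \<nu> ! i" using a by (auto simp: in_set_conv_nth)
    then show ?thesis using part_antimono[OF \<nu>(1), of 1 "Suc i"] by (simp add: part_Suc)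
  qed
  have "is_partition \<mu>"
    using \<nu>(1) \<open>- 1 \<le> x\<close> top le by (fastforce simp: \<mu>_def is_partition_def)
  moreover have "length \<mu> \<le> Suc N" using \<nu>(2) by (simp add: \<mu>_def)
  moreover have "(\<lambda>i. int (part \<mu> i) - int i) ` {1..Suc N} = S"
  proof -
    have one: "int (part \<mu> 1) - int 1 = x"
      using \<open>- 1 \<le> x\<close> nil by (auto simp: \<mu>_def)
    have suc: "int (part \<mu> (Suc i)) - int (Suc i) = (int (part \<nu> i) - int i) - 1" if "i \<in> {1..N}" for i
      using nil that by (auto simp: \<mu>_def)
    have "{1..Suc N} = insert 1 (Suc ` {1..N})" by (auto simp: image_Suc_atLeastAtMost)
    then have "(\<lambda>i. int (part \<mu> i) - int i) ` {1..Suc N} =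
        insert x ((\<lambda>i. int (part \<mu> (Suc i)) - int (Suc i)) ` {1..N})"
      using one by (simp only: image_insert image_image)
    also have "(\<lambda>i. int (part \<mu> (Suc i)) - int (Suc i)) ` {1..N} =
        (\<lambda>i. (int (part \<nu> i) - int i) - 1) ` {1..N}"
      using suc by (rule image_cong[OF refl])
    also have "(\<lambda>i. (int (part \<nu> i) - int i) - 1) ` {1..N} = (\<lambda>y. y - 1) ` S'"
      unfolding \<nu>(3)[symmetric] by (simp only: image_image)
    also have "\<dots> = S - {x}" by (simp add: S'_def image_image)
    finally show ?thesis using x(1) by auto
  qed
  ultimately show ?case by blast
qed

text \<open>Having exactly \<open>N\<close> elements from \<open>- int N\<close> upwards and
  everything below says that there are as many nonnegative elements as negative gaps, that is,
  charge zero.\<close>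

lemma beads_realised:
  assumes "finite (S \<inter> {- int N..})" "card (S \<inter> {- int N..}) = N" "\<And>x. x < - int N \<Longrightarrow> x \<in> S"
  obtains \<nu> where "is_partition \<nu>" "beads \<nu> = S"
proof -
  obtain \<nu> where \<nu>: "is_partition \<nu>" "length \<nu> \<le> N"
      "(\<lambda>i. int (part \<nu> i) - int i) ` {1..N} = S \<inter> {- int N..}"
    using finite_beads_realised[OF assms(1,2)] by blast
  have above: "beads \<nu> \<inter> {- int N..} = S \<inter> {- int N..}" using beads_above[OF \<nu>(2)] \<nu>(3) by simp
  have "x \<in> beads \<nu> \<longleftrightarrow> x \<in> S" for x
  proof (cases "x < - int N")
    case True
    then show ?thesis using beads_below[OF \<nu>(2)] assms(3) by simp
  next
    case False
    have "x \<in> beads \<nu> \<inter> {- int N..} \<longleftrightarrow> x \<in> S \<inter> {- int N..}" by (simp only: above)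
    with False show ?thesis by simp
  qed
  then have "beads \<nu> = S" by blast
  then show thesis by (rule that[OF \<nu>(1)])
qed

lemma card_beads_above:
  assumes "is_partition \<nu>" "length \<nu> \<le> N"
  shows "card (beads \<nu> \<inter> {- int N..}) = N"
proof -
  have "inj_on (\<lambda>i. int (part \<nu> i) - int i) {1..N}"
    using bead_inj_on[OF assms(1)] by (rule inj_on_subset) auto
  from card_image[OF this] show ?thesis by (simp add: beads_above[OF assms(2)])
qed

lemma sum_beads_above:
  assumes "is_partition \<nu>" "length \<nu> \<le> N"
  shows "2 * \<Sum>(beads \<nu> \<inter> {- int N..}) = 2 * int (weight \<nu>) - int N * (int N + 1)"
proof -
  have inj: "inj_on (\<lambda>i. int (part \<nu> i) - int i) {1..N}"
    using bead_inj_on[OF assms(1)] by (rule inj_on_subset) auto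
  have "\<Sum>(beads \<nu> \<inter> {- int N..}) = (\<Sum>i = 1..N. int (part \<nu> i) - int i)"
    unfolding beads_above[OF assms(2)] sum.reindex[OF inj] by simp
  also have "\<dots> = int (weight \<nu>) - (\<Sum>i = 1..N. int i)"
    using sum_part[OF assms(2)] by (simp add: sum_subtractf flip: of_nat_sum)
  finally have "2 * \<Sum>(beads \<nu> \<inter> {- int N..}) = 2 * int (weight \<nu>) - 2 * (\<Sum>i = 1..N. int i)"
    by simp
  moreover have "2 * (\<Sum>i = 1..N. int i) = int N * (int N + 1)"
    by (induction N) (auto simp: algebra_simps)
  ultimately show ?thesis by simp
qed

section \<open>Flush abaci: count and sum of their beads\<close>

text \<open>The bead set of an abacus with \<open>p\<close> runners all of whose beads are pushed down: \<open>x mod p\<close> is the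
  runner of the position \<open>x\<close>, and \<open>x div p\<close> its height on that runner.\<close>

definition flush_beads :: "nat \<Rightarrow> (nat \<Rightarrow> int) \<Rightarrow> int set" where
  "flush_beads p m = {x. x div int p < m (nat (x mod int p))}"

lemma flush_beads_iff:
  "k < p \<Longrightarrow> int k + int p * s \<in> flush_beads p m \<longleftrightarrow> s < m k"
  by (simp add: flush_beads_def)

lemma runner_decomp:
  assumes "0 < p"
  obtains k s where "k < p" "x = int k + int p * s"
proof
  show "nat (x mod int p) < p" using assms by (simp add: nat_less_iff)
  show "x = int (nat (x mod int p)) + int p * (x div int p)" using assms by simp
qed

lemma flush_beads_eqI:
  assumes "0 < p" "\<And>k s. k < p \<Longrightarrow> int k + int p * s \<in> S \<longleftrightarrow> s < m k"
  shows "S = flush_beads p m"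
proof (intro set_eqI)
  fix x
  obtain k s where "k < p" "x = int k + int p * s" by (rule runner_decomp[OF assms(1)])
  then show "x \<in> S \<longleftrightarrow> x \<in> flush_beads p m" using assms(2) by (simp add: flush_beads_iff)
qed

text \<open>A cut at a multiple \<open>- int (p * M)\<close> of \<open>p\<close> cuts every runner
  at the same height \<open>- int M\<close>, so the truncated set is a disjoint union of intervals
  of heights.\<close>

lemma flush_beads_bij:
  assumes "0 < p"
  shows "bij_betw (\<lambda>(k, s). int k + int p * s) (SIGMA k:{..<p}. {- int M..<m k})
    (flush_beads p m \<inter> {- int (p * M)..})"
proof (rule bij_betw_byWitness[where f' = "\<lambda>x. (nat (x mod int p), x div int p)"])
  have ge: "- int (p * M) \<le> int k + int p * s \<longleftrightarrow> - int M \<le> s" if "k < p" for k s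
  proof
    assume "- int M \<le> s"
    then have "int p * (- int M) \<le> int p * s" by (intro mult_left_mono) auto
    then show "- int (p * M) \<le> int k + int p * s" by simp
  next
    assume *: "- int (p * M) \<le> int k + int p * s"
    show "- int M \<le> s"
    proof (rule ccontr)
      assume "\<not> - int M \<le> s"
      then have "int p * (s + 1) \<le> int p * (- int M)" by (intro mult_left_mono) auto
      with * that show False by (simp add: algebra_simps)
    qed
  qed
  show "(\<lambda>(k, s). int k + int p * s) ` (SIGMA k:{..<p}. {- int M..<m k})
      \<subseteq> flush_beads p m \<inter> {- int (p * M)..}"
    using ge by (auto simp: flush_beads_iff)
  show "(\<lambda>x. (nat (x mod int p), x div int p)) ` (flush_beads p m \<inter> {- int (p * M)..})
      \<subseteq> (SIGMA k:{..<p}. {- int M..<m k})"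
  proof
    fix z assume "z \<in> (\<lambda>x. (nat (x mod int p), x div int p)) ` (flush_beads p m \<inter> {- int (p * M)..})"
    then obtain x where x: "z = (nat (x mod int p), x div int p)" "x \<in> flush_beads p m" "- int (p * M) \<le> x"
      by auto
    obtain k s where "k < p" "x = int k + int p * s" by (rule runner_decomp[OF assms])
    with x ge show "z \<in> (SIGMA k:{..<p}. {- int M..<m k})" by (simp add: flush_beads_iff)
  qed
qed (auto simp: assms)

lemma two_sum_int_interval:
  fixes a b :: int
  assumes "a \<le> b"
  shows "2 * \<Sum>{a..<b} = b * (b - 1) - a * (a - 1)"
  using assms
proof (induction b rule: int_ge_induct)
  case (step b)
  have "{a..<b + 1} = insert b {a..<b}" using step.hyps by auto
  then show ?case using step.IH by (simp add: algebra_simps)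
qed simp

lemma finite_flush_beads_above: "0 < p \<Longrightarrow> finite (flush_beads p m \<inter> {- int (p * M)..})"
  using bij_betw_finite[OF flush_beads_bij] by fastforce

lemma card_flush_beads_above:
  assumes "0 < p" "\<And>k. k < p \<Longrightarrow> - int M \<le> m k"
  shows "int (card (flush_beads p m \<inter> {- int (p * M)..})) = (\<Sum>k<p. m k) + int (p * M)"
proof -
  have "card (flush_beads p m \<inter> {- int (p * M)..}) = (\<Sum>k<p. nat (m k + int M))"
    by (subst bij_betw_same_card[OF flush_beads_bij[OF assms(1)], symmetric]) simp
  also have "int \<dots> = (\<Sum>k<p. m k + int M)"
    unfolding of_nat_sum by (intro sum.cong) (use assms(2) in fastforce)+
  finally show ?thesis by (simp add: sum.distrib)
qed

text \<open>Each runner contributes an arithmetic progression. The terms linear in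
  \<open>M * m k\<close> never survive, and the vanishing sum of the \<open>m k\<close> removes the
  remaining linear term. What depends on \<open>M\<close> alone is \<open>- N * (N + 1)\<close> with
  \<open>N = p * M\<close>, the same correction as in \<open>sum_beads_above\<close>, so it cancels
  when the two are compared.\<close>

lemma sum_flush_beads_above:
  assumes "0 < p" "\<And>k. k < p \<Longrightarrow> - int M \<le> m k" "(\<Sum>k<p. m k) = 0"
  shows "2 * \<Sum>(flush_beads p m \<inter> {- int (p * M)..}) =
    int p * (\<Sum>k<p. (m k)\<^sup>2) + 2 * (\<Sum>k<p. int k * m k) - int (p * M) * (int (p * M) + 1)"
proof -
  have ids: "2 * (\<Sum>k<p. int k) = int p * (int p - 1)"
    by (induction p) (auto simp: algebra_simps)
  have "\<Sum>(flush_beads p m \<inter> {- int (p * M)..}) =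
      (\<Sum>(k, s)\<in>(SIGMA k:{..<p}. {- int M..<m k}). int k + int p * s)"
    by (subst sum.reindex_bij_betw[OF flush_beads_bij[OF assms(1)], symmetric])
      (simp add: case_prod_unfold)
  also have "\<dots> = (\<Sum>k<p. \<Sum>s\<in>{- int M..<m k}. int k + int p * s)"
    by (subst sum.Sigma) auto
  also have "2 * \<dots> = (\<Sum>k<p. 2 * (int k * (m k + int M)) +
      int p * (m k * (m k - 1) - int M * (int M + 1)))"
    unfolding sum_distrib_left[of 2 _ "{..<p}"]
  proof (intro sum.cong refl)
    fix k assume "k \<in> {..<p}"
    then have le: "- int M \<le> m k" using assms(2) by simp
    have "2 * (\<Sum>s\<in>{- int M..<m k}. int k + int p * s) =
        2 * (int k * (m k + int M)) + int p * (2 * \<Sum>{- int M..<m k})"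
      using le by (simp add: sum.distrib sum_distrib_left algebra_simps)
    then show "2 * (\<Sum>s\<in>{- int M..<m k}. int k + int p * s) =
        2 * (int k * (m k + int M)) + int p * (m k * (m k - 1) - int M * (int M + 1))"
      unfolding two_sum_int_interval[OF le] by (simp add: algebra_simps)
  qed
  also have "\<dots> = (\<Sum>k<p. 2 * (int k * m k) + int M * (2 * int k) + int p * (m k)\<^sup>2
      - int p * m k - int p * (int M * (int M + 1)))"
    by (intro sum.cong) (auto simp: algebra_simps power2_eq_square)
  also have "\<dots> = 2 * (\<Sum>k<p. int k * m k) + int M * (2 * (\<Sum>k<p. int k)) + int p * (\<Sum>k<p. (m k)\<^sup>2)
      - int p * (\<Sum>k<p. m k) - int p * (int p * (int M * (int M + 1)))"
    by (simp only: sum.distrib sum_subtractf sum_distrib_left sum_constant card_lessThan of_nat_id)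
  finally show ?thesis
    unfolding ids assms(3) by (simp add: algebra_simps)
qed

subsection \<open>The vector of a core\<close>

text \<open>On a residue class modulo \<open>p\<close> the occupied heights are closed downwards,
  nonempty and bounded above, so they form a ray; \<open>m\<close> is one more than the greatest of
  them.\<close>

lemma core_runner:
  assumes "is_core p \<nu>" "0 < p"
  obtains m where "\<And>s. x + int p * s \<in> beads \<nu> \<longleftrightarrow> s < m"
proof -
  have part: "is_partition \<nu>" using assms(1) by (simp add: is_core_def)
  have closed: "y - int p \<in> beads \<nu>" if "y \<in> beads \<nu>" for y
    using is_core_iff_beads[OF part assms(2)] assms(1) that by blast
  define P where "P s \<longleftrightarrow> x + int p * s \<in> beads \<nu>" for s
  have step: "P (s - 1)" if "P s" for s
    using closed that by (fastforce simp: P_def algebra_simps)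
  have down: "P s'" if "P s" "s' \<le> s" for s s'
    using that(2,1) by (induction s' rule: int_le_induct) (auto intro: step)
  have le: "s \<le> int p * s" if "0 \<le> s" for s using assms(2) that by (simp add: mult_le_cancel_right1)
  \<comment> \<open>This height is low enough that even a step of 1 per level would put the position
    below \<open>- length \<nu>\<close>, where every integer is a bead.\<close>
  have "P (- (\<bar>x\<bar> + int (length \<nu>) + 1))"
    unfolding P_def using le[of "\<bar>x\<bar> + int (length \<nu>) + 1"]
    by (intro beads_below[OF order_refl]) (simp only: mult_minus_right, linarith)
  moreover have "s \<le> \<bar>x\<bar> + int (part \<nu> 1)" if s: "P s" for s
  proof (cases "0 \<le> s")
    case True
    obtain i where "1 \<le> i" "x + int p * s = int (part \<nu> i) - int i" using s by (auto simp: P_def beads_def)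
    then show ?thesis using le[OF True] part_antimono[OF part order_refl, of i] by linarith
  qed simp
  ultimately obtain a b where ab: "P a" "\<And>s. P s \<Longrightarrow> s \<le> b" by blast
  define T where "T = {s. P s} \<inter> {a..b}"
  have T: "finite T" "a \<in> T" using ab by (auto simp: T_def)
  have "P s \<longleftrightarrow> s < Max T + 1" for s
  proof
    assume "P s"
    show "s < Max T + 1"
    proof (cases "a \<le> s")
      case True
      then have "s \<in> T" using \<open>P s\<close> ab by (simp add: T_def)
      from Max_ge[OF T(1) this] show ?thesis by simp
    next
      case False
      with Max_ge[OF T] show ?thesis by simp
    qed
  next
    assume "s < Max T + 1"
    moreover have "P (Max T)" using Max_in[OF T(1)] T(2) unfolding T_def by blast
    ultimately show "P s" using down by simp
  qed
  then show thesis using that unfolding P_def by blast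
qed

lemma length_core_vector: "length (core_vector t \<nu>) = t + 1"
  by (simp add: core_vector_def)

text \<open>The congruence and the window of length \<open>t + 1\<close> admit only the position
  \<open>k + (t + 1) (r - 1)\<close>, so the entry is the greatest \<open>r\<close> with a bead at
  height \<open>r - 1\<close>. This shift is why heights satisfy a strict inequality
  \<open>s < m\<close>.\<close>

lemma core_vector_eqI:
  assumes "k < t + 1" "\<And>s. int k + int (t + 1) * s \<in> beads \<nu> \<longleftrightarrow> s < m"
  shows "core_vector t \<nu> ! k = m"
proof -
  have iff: "(\<exists>i \<ge> 1. [int (part \<nu> i) - int i = int k] (mod (int t + 1)) \<and>
       (int t + 1) * (r - 1) \<le> int (part \<nu> i) - int i \<and>
       int (part \<nu> i) - int i < (int t + 1) * r) \<longleftrightarrow> r \<le> m" (is "?L \<longleftrightarrow> _") for r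
  proof -
    have eq: "[x = int k] (mod (int t + 1)) \<and> (int t + 1) * (r - 1) \<le> x \<and> x < (int t + 1) * r
        \<longleftrightarrow> x = int k + (int t + 1) * (r - 1)" (is "?C \<longleftrightarrow> _") for x
    proof
      assume C: ?C
      have "x div (int t + 1) = r - 1"
        by (rule int_div_pos_eq[of _ _ _ "x - (int t + 1) * (r - 1)"]) (use C in \<open>auto simp: algebra_simps\<close>)
      moreover have "x mod (int t + 1) = int k"
      proof -
        have "int k mod (int t + 1) = int k" using assms(1) by simp
        with C show ?thesis unfolding cong_def by argo
      qed
      ultimately show "x = int k + (int t + 1) * (r - 1)"
        by (metis mult_div_mod_eq add.commute)
    next
      assume x: "x = int k + (int t + 1) * (r - 1)"
      have "[x = int k] (mod (int t + 1))" unfolding x cong_def by (rule mod_mult_self2)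
      moreover have "x < (int t + 1) * r" using assms(1) by (simp add: x algebra_simps)
      ultimately show ?C by (simp add: x)
    qed
    have "?L \<longleftrightarrow> int k + (int t + 1) * (r - 1) \<in> beads \<nu>"
      by (simp only: eq mem_beads_iff)
    also have "\<dots> \<longleftrightarrow> r \<le> m" using assms(2)[of "r - 1"] by (auto simp: add.commute)
    finally show ?thesis .
  qed
  have "core_vector t \<nu> ! k = (GREATEST r. r \<le> m)"
    using assms(1) by (simp add: core_vector_def iff del: upt_Suc One_nat_def)
  then show ?thesis using Greatest_equality[of "\<lambda>r. r \<le> m" m] by simp
qed

lemma mem_beads_iff_core_vector:
  assumes "is_core (t + 1) \<nu>" "k < t + 1"
  shows "int k + int (t + 1) * s \<in> beads \<nu> \<longleftrightarrow> s < core_vector t \<nu> ! k"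
proof -
  obtain m where m: "\<And>s. int k + int (t + 1) * s \<in> beads \<nu> \<longleftrightarrow> s < m"
    by (rule core_runner[OF assms(1), of "int k"]) auto
  with core_vector_eqI[OF assms(2) m] show ?thesis by simp
qed

lemma beads_core:
  assumes "is_core (t + 1) \<nu>"
  shows "beads \<nu> = flush_beads (t + 1) ((!) (core_vector t \<nu>))"
  by (rule flush_beads_eqI) (use mem_beads_iff_core_vector[OF assms] in auto)

text \<open>The beads above a common cut are counted and summed in two ways, by rows and by
  runners.\<close>

lemma core_charge_and_weight:
  assumes "is_core (t + 1) \<nu>"
  shows core_vector_sum: "(\<Sum>k<t + 1. core_vector t \<nu> ! k) = 0"
    and core_weight: "2 * int (weight \<nu>) = int (t + 1) * (\<Sum>k<t + 1. (core_vector t \<nu> ! k)\<^sup>2)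
      + 2 * (\<Sum>k<t + 1. int k * core_vector t \<nu> ! k)"
proof -
  let ?m = "(!) (core_vector t \<nu>)"
  have part: "is_partition \<nu>" using assms by (simp add: is_core_def)
  \<comment> \<open>Large enough that the cut at \<open>- (t + 1) M\<close> lies below all nonzero
    rows and no runner is occupied only up to a height below the cut.\<close>
  define M where "M = length \<nu> + nat (\<Sum>k<t + 1. \<bar>?m k\<bar>)"
  have len: "length \<nu> \<le> (t + 1) * M" by (simp add: M_def)
  have M: "- int M \<le> ?m k" if "k < t + 1" for k
  proof -
    have "\<bar>?m k\<bar> \<le> (\<Sum>k<t + 1. \<bar>?m k\<bar>)" using that by (intro member_le_sum) auto
    then show ?thesis unfolding M_def by linarith
  qed
  show sum: "(\<Sum>k<t + 1. ?m k) = 0"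
    using card_flush_beads_above[of "t + 1" M ?m] card_beads_above[OF part len] beads_core[OF assms] M
    by simp
  show "2 * int (weight \<nu>) = int (t + 1) * (\<Sum>k<t + 1. (?m k)\<^sup>2) + 2 * (\<Sum>k<t + 1. int k * ?m k)"
    using sum_flush_beads_above[of "t + 1" M ?m] sum_beads_above[OF part len] beads_core[OF assms] M sum
    by simp
qed

text \<open>The vanishing sum gives the flush bead set charge zero, so a partition realises it;
  being closed under subtraction of \<open>t + 1\<close>, it belongs to a core.\<close>

lemma core_vector_surj:
  assumes "(\<Sum>k<t + 1. m k) = 0"
  obtains \<nu> where "is_core (t + 1) \<nu>" "\<And>k. k < t + 1 \<Longrightarrow> core_vector t \<nu> ! k = m k"
proof -
  define M where "M = nat (\<Sum>k<t + 1. \<bar>m k\<bar>)"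
  have M: "- int M \<le> m k" if "k < t + 1" for k
  proof -
    have "\<bar>m k\<bar> \<le> (\<Sum>k<t + 1. \<bar>m k\<bar>)" using that by (intro member_le_sum) auto
    then show ?thesis unfolding M_def by linarith
  qed
  let ?S = "flush_beads (t + 1) m"
  have "x \<in> ?S" if "x < - int ((t + 1) * M)" for x
  proof -
    obtain k s where x: "k < t + 1" "x = int k + int (t + 1) * s" by (rule runner_decomp[of "t + 1" x]) auto
    have "s < - int M"
    proof (rule ccontr)
      assume "\<not> s < - int M"
      then have "int (t + 1) * (- int M) \<le> int (t + 1) * s" by (intro mult_left_mono) auto
      with x that show False by (simp add: algebra_simps)
    qed
    then show ?thesis using M[OF x(1)] unfolding x(2) flush_beads_iff[OF x(1)] by simp
  qed
  moreover have "card (?S \<inter> {- int ((t + 1) * M)..}) = (t + 1) * M"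
    using card_flush_beads_above[of "t + 1" M m] M assms
    by (simp only: add_0 of_nat_eq_iff zero_less_Suc flip: Suc_eq_plus1)
  ultimately obtain \<nu> where \<nu>: "is_partition \<nu>" "beads \<nu> = ?S"
    using beads_realised[of ?S "(t + 1) * M"] finite_flush_beads_above[of "t + 1" m M] by auto
  have "x - int (t + 1) \<in> ?S" if "x \<in> ?S" for x
  proof -
    obtain k s where x: "k < t + 1" "x = int k + int (t + 1) * s" by (rule runner_decomp[of "t + 1" x]) auto
    have "x - int (t + 1) = int k + int (t + 1) * (s - 1)" by (simp add: x algebra_simps)
    then show ?thesis using that x(1) by (simp only: x(2) flush_beads_iff)
  qed
  then have "is_core (t + 1) \<nu>" using is_core_iff_beads[OF \<nu>(1), of "t + 1"] \<nu>(2) by simp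
  moreover have "core_vector t \<nu> ! k = m k" if "k < t + 1" for k
    by (rule core_vector_eqI[OF that]) (simp only: \<nu>(2) flush_beads_iff[OF that])
  ultimately show thesis using that by blast
qed

lemma core_eqI:
  assumes "is_core (t + 1) \<nu>" "is_core (t + 1) \<mu>"
    "\<And>k. k < t + 1 \<Longrightarrow> core_vector t \<nu> ! k = core_vector t \<mu> ! k"
  shows "\<nu> = \<mu>"
proof (rule beads_inject)
  show "beads \<nu> = beads \<mu>"
    unfolding beads_core[OF assms(2)]
    by (rule flush_beads_eqI) (use mem_beads_iff_core_vector[OF assms(1)] assms(3) in auto)
qed (use assms in \<open>auto simp: is_core_def\<close>)

section \<open>Symmetries of the core vector\<close>

lemma reflected_threshold_iff:
  fixes a b :: int
  shows "(\<forall>s. s < a \<longleftrightarrow> \<not> - s - 1 < b) \<longleftrightarrow> b = - a"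
proof
  assume *: "\<forall>s. s < a \<longleftrightarrow> \<not> - s - 1 < b"
  from *[rule_format, of a] *[rule_format, of "a - 1"] show "b = - a" by simp
qed auto

text \<open>The reflection \<open>x \<mapsto> - 1 - x\<close> sends height \<open>s\<close> on
  runner \<open>k\<close> to height \<open>- s - 1\<close> on runner \<open>t - k\<close>.\<close>

lemma SC_iff_core_vector:
  "\<nu> \<in> SC (t + 1) \<longleftrightarrow> is_core (t + 1) \<nu> \<and> (\<forall>k \<le> t. core_vector t \<nu> ! (t - k) = - core_vector t \<nu> ! k)"
proof (cases "is_core (t + 1) \<nu>")
  case True
  let ?m = "(!) (core_vector t \<nu>)"
  have part: "is_partition \<nu>" using True by (simp add: is_core_def)
  have refl: "- 1 - (int k + int (t + 1) * s) \<in> beads \<nu> \<longleftrightarrow> - s - 1 < ?m (t - k)" if "k \<le> t" for k s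
  proof -
    have "- 1 - (int k + int (t + 1) * s) = int (t - k) + int (t + 1) * (- s - 1)"
      using that by (simp add: of_nat_diff algebra_simps)
    then show ?thesis using mem_beads_iff_core_vector[OF True, of "t - k"] by simp
  qed
  have "conjugate \<nu> = \<nu> \<longleftrightarrow> (\<forall>k \<le> t. \<forall>s. s < ?m k \<longleftrightarrow> \<not> - s - 1 < ?m (t - k))"
  proof (unfold self_conjugate_iff_beads[OF part], rule iffI)
    assume *: "\<forall>x. x \<in> beads \<nu> \<longleftrightarrow> - 1 - x \<notin> beads \<nu>"
    show "\<forall>k \<le> t. \<forall>s. s < ?m k \<longleftrightarrow> \<not> - s - 1 < ?m (t - k)"
    proof (intro allI impI)
      fix k s assume k: "k \<le> t"
      then have "k < t + 1" by simp
      with spec[OF *, of "int k + int (t + 1) * s"] show "s < ?m k \<longleftrightarrow> \<not> - s - 1 < ?m (t - k)"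
        by (simp only: refl[OF k] mem_beads_iff_core_vector[OF True])
    qed
  next
    assume *: "\<forall>k \<le> t. \<forall>s. s < ?m k \<longleftrightarrow> \<not> - s - 1 < ?m (t - k)"
    show "\<forall>x. x \<in> beads \<nu> \<longleftrightarrow> - 1 - x \<notin> beads \<nu>"
    proof
      fix x
      obtain k s where k: "k < t + 1" and x: "x = int k + int (t + 1) * s" by (rule runner_decomp[of "t + 1" x]) auto
      then have "k \<le> t" by simp
      from *[rule_format, OF this, of s] show "x \<in> beads \<nu> \<longleftrightarrow> - 1 - x \<notin> beads \<nu>"
        unfolding x refl[OF \<open>k \<le> t\<close>] mem_beads_iff_core_vector[OF True k] .
    qed
  qed
  then show ?thesis using True by (simp add: SC_def reflected_threshold_iff)
qed (simp add: SC_def)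

text \<open>The reflection \<open>x \<mapsto> - x\<close> sends height \<open>s\<close> on runner
  \<open>k \<ge> 1\<close> to height \<open>- s - 1\<close> on runner \<open>t + 1 - k\<close>.
  Runner 0 is mapped to itself by \<open>s \<mapsto> - s\<close> and is treated separately.\<close>

lemma DD_iff_core_vector:
  "\<nu> \<in> DD (t + 1) \<longleftrightarrow> is_core (t + 1) \<nu> \<and> core_vector t \<nu> ! 0 = 0 \<and>
    (\<forall>k \<in> {1..t}. core_vector t \<nu> ! (t + 1 - k) = - core_vector t \<nu> ! k)"
proof (cases "is_core (t + 1) \<nu>")
  case True
  let ?m = "(!) (core_vector t \<nu>)"
  have part: "is_partition \<nu>" using True by (simp add: is_core_def)
  note mem = mem_beads_iff_core_vector[OF True]
  have zero: "int (t + 1) * s \<in> beads \<nu> \<longleftrightarrow> s < ?m 0" for s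
    using mem[of 0] by simp
  have refl: "- (int k + int (t + 1) * s) \<in> beads \<nu> \<longleftrightarrow> - s - 1 < ?m (t + 1 - k)" if "k \<in> {1..t}" for k s
  proof -
    have "- (int k + int (t + 1) * s) = int (t + 1 - k) + int (t + 1) * (- s - 1)"
      using that by (simp add: of_nat_diff algebra_simps)
    moreover have "t + 1 - k < t + 1" using that by auto
    ultimately show ?thesis using mem[of "t + 1 - k"] by simp
  qed
  have "doubled_distinct \<nu> \<longleftrightarrow> ?m 0 = 0 \<and> (\<forall>k \<in> {1..t}. \<forall>s. s < ?m k \<longleftrightarrow> \<not> - s - 1 < ?m (t + 1 - k))"
    (is "_ \<longleftrightarrow> ?R")
  proof
    assume "doubled_distinct \<nu>"
    then have "0 \<notin> beads \<nu>" and sym: "\<And>x. x \<noteq> 0 \<Longrightarrow> x \<in> beads \<nu> \<longleftrightarrow> - x \<notin> beads \<nu>"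
      unfolding doubled_distinct_iff_beads[OF part] by blast+
    have "\<not> 0 < ?m 0" using zero[of 0] \<open>0 \<notin> beads \<nu>\<close> by simp
    \<comment> \<open>The positions \<open>t + 1\<close> and \<open>- (t + 1)\<close> on runner 0:
      the first is a gap since the threshold is at most 0, so the second is a bead and the threshold
      exceeds -1.\<close>
    moreover have "1 < ?m 0 \<longleftrightarrow> \<not> - 1 < ?m 0"
      using zero[of 1] zero[of "- 1"] sym[of "int (t + 1)"] by simp
    ultimately have "?m 0 = 0" by linarith
    moreover have "s < ?m k \<longleftrightarrow> \<not> - s - 1 < ?m (t + 1 - k)" if k: "k \<in> {1..t}" for k s
    proof -
      have "int k + int (t + 1) * s \<noteq> 0"
      proof
        assume "int k + int (t + 1) * s = 0"
        then have "(int k + int (t + 1) * s) mod int (t + 1) = 0" by simp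
        then show False using k by (simp only: mod_mult_self2) simp
      qed
      from sym[OF this] show ?thesis
        using k mem[of k s] refl[OF k, of s] by (simp only: atLeastAtMost_iff less_Suc_eq_le Suc_eq_plus1[symmetric])
    qed
    ultimately show ?R by blast
  next
    assume R: ?R
    have "0 \<notin> beads \<nu>" using zero[of 0] R by simp
    moreover have "x \<in> beads \<nu> \<longleftrightarrow> - x \<notin> beads \<nu>" if "x \<noteq> 0" for x
    proof -
      obtain k s where k: "k < t + 1" and x: "x = int k + int (t + 1) * s" by (rule runner_decomp[of "t + 1" x]) auto
      show ?thesis
      proof (cases "k = 0")
        case True
        with x that have "s \<noteq> 0" and "x = int (t + 1) * s" by auto
        with zero[of s] zero[of "- s"] R show ?thesis by auto
      next
        case False
        with k have k': "k \<in> {1..t}" by simp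
        with R have "s < ?m k \<longleftrightarrow> \<not> - s - 1 < ?m (t + 1 - k)" by blast
        then show ?thesis unfolding x refl[OF k'] mem[OF k] .
      qed
    qed
    ultimately show "doubled_distinct \<nu>"
      unfolding doubled_distinct_iff_beads[OF part] by blast
  qed
  then show ?thesis using True by (simp add: DD_def reflected_threshold_iff)
qed (simp add: DD_def)

section \<open>Principal hook lengths read off the beads\<close>

lemma mem_boxes_diag: "is_partition \<nu> \<Longrightarrow> (i, i) \<in> boxes \<nu> \<longleftrightarrow> i \<in> {1..durfee \<nu>}"
  using durfee_iff[of \<nu> i] by (auto simp: mem_boxes_iff)

lemma principal_hook_lengths_eq:
  "is_partition \<nu> \<Longrightarrow> principal_hook_lengths \<nu> = (\<lambda>i. hook_length \<nu> i i) ` {1..durfee \<nu>}"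
  unfolding principal_hook_lengths_def by (simp only: mem_boxes_diag) blast

lemma principal_hook_lengths_SC:
  assumes "\<nu> \<in> SC p"
  shows "principal_hook_lengths \<nu> = (\<lambda>x. 2 * x + 1) ` {x \<in> beads \<nu>. 0 \<le> x}"
proof -
  have part: "is_partition \<nu>" and conj: "conjugate \<nu> = \<nu>"
    using assms by (auto simp: SC_def is_core_def)
  show ?thesis
    unfolding principal_hook_lengths_eq[OF part] nonneg_beads[OF part, symmetric] image_image
    by (intro image_cong) (auto simp: hook_length_def conj)
qed

text \<open>On the diagonal the column is shorter than the row by 1, which gives twice the bead; 0
  is a gap, so the nonnegative beads are all positive.\<close>

lemma principal_hook_lengths_DD:
  assumes "\<nu> \<in> DD p"
  shows "principal_hook_lengths \<nu> = (\<lambda>x. 2 * x) ` {x \<in> beads \<nu>. 0 < x}"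
proof -
  have part: "is_partition \<nu>" and dd: "doubled_distinct \<nu>"
    using assms by (auto simp: DD_def is_core_def)
  have "{x \<in> beads \<nu>. 0 < x} = {x \<in> beads \<nu>. 0 \<le> x}"
  proof -
    have "0 \<notin> beads \<nu>" using dd unfolding doubled_distinct_iff_beads[OF part] by blast
    then show ?thesis by (auto simp: order_le_less)
  qed
  then have pos: "{x \<in> beads \<nu>. 0 < x} = (\<lambda>i. int (part \<nu> i) - int i) ` {1..durfee \<nu>}"
    by (simp only: nonneg_beads[OF part])
  show ?thesis
    unfolding principal_hook_lengths_eq[OF part] pos image_image
    by (intro image_cong) (use dd in \<open>auto simp: hook_length_def doubled_distinct_def\<close>)
qed

subsection \<open>The pair of a self-conjugate and a doubled distinct core\<close>

text \<open>Interleaving the two bead sets: doubling turns the symmetries \<open>x \<mapsto> - 1 - x\<close> (self-conjugate) and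
  \<open>x \<mapsto> - x\<close> (doubled distinct) both into \<open>y \<mapsto> - y\<close>, and the principal hook lengths become exactly the
  positive elements.\<close>

definition doubled_beads :: "nat list \<Rightarrow> nat list \<Rightarrow> int set" where
  "doubled_beads lam \<mu> = {y. if odd y then y div 2 \<in> beads lam else y div 2 \<in> beads \<mu>}"

lemma Delta_eq_doubled_beads:
  assumes "lam \<in> SC p" "\<mu> \<in> DD p"
  shows "Delta lam \<mu> = {h \<in> doubled_beads lam \<mu>. 0 < h}"
proof (intro set_eqI)
  fix h
  have "h \<in> (\<lambda>x. 2 * x + 1) ` {x \<in> beads lam. 0 \<le> x} \<longleftrightarrow> odd h \<and> h div 2 \<in> beads lam \<and> 0 < h"
    by (auto elim!: oddE)
  moreover have "h \<in> (\<lambda>x. 2 * x) ` {x \<in> beads \<mu>. 0 < x} \<longleftrightarrow> even h \<and> h div 2 \<in> beads \<mu> \<and> 0 < h"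
    by (auto elim!: evenE)
  ultimately show "h \<in> Delta lam \<mu> \<longleftrightarrow> h \<in> {h \<in> doubled_beads lam \<mu>. 0 < h}"
    unfolding Delta_def principal_hook_lengths_SC[OF assms(1)] principal_hook_lengths_DD[OF assms(2)]
    by (auto simp: doubled_beads_def)
qed

text \<open>An odd function on \<open>{- t..t}\<close> whose restriction to \<open>{1..t}\<close> is the vector \<open>varphi t (lam, \<mu>)\<close>; the
  remaining entry \<open>0\<close> of the core vector of \<open>\<mu>\<close> vanishes.\<close>

definition doubled_vector :: "nat \<Rightarrow> nat list \<Rightarrow> nat list \<Rightarrow> int \<Rightarrow> int" where
  "doubled_vector t lam \<mu> z =
    (if even (int t + z) then core_vector t lam ! nat ((int t + z) div 2)
     else core_vector t \<mu> ! nat ((int t + 1 + z) div 2))"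

lemma doubled_vector_even: "doubled_vector t lam \<mu> (2 * int k - int t) = core_vector t lam ! k"
  by (simp add: doubled_vector_def)

lemma doubled_vector_odd: "doubled_vector t lam \<mu> (2 * int k - int t - 1) = core_vector t \<mu> ! k"
  by (simp add: doubled_vector_def)

text \<open>The index 0 is absent in the second case because it would give
  \<open>z = - t - 1\<close>, outside the range.\<close>

lemma doubled_cases [consumes 1, case_names SC DD]:
  assumes "\<bar>z\<bar> \<le> int t"
  obtains k where "k \<le> t" "z = 2 * int k - int t" | k where "k \<in> {1..t}" "z = 2 * int k - int t - 1"
proof (cases "even (int t + z)")
  case True
  then obtain c where "int t + z = 2 * c" by (elim evenE)
  then show thesis using assms by (intro that(1)[of "nat c"]) auto
next
  case False
  then obtain c where "int t + z = 2 * c + 1" by (elim oddE)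
  then show thesis using assms by (intro that(2)[of "nat (c + 1)"]) auto
qed

lemma doubled_vector_minus:
  assumes "lam \<in> SC (t + 1)" "\<mu> \<in> DD (t + 1)" "\<bar>z\<bar> \<le> int t"
  shows "doubled_vector t lam \<mu> (- z) = - doubled_vector t lam \<mu> z"
  using assms(3)
proof (cases rule: doubled_cases)
  case (SC k)
  then have "- z = 2 * int (t - k) - int t" by (simp add: of_nat_diff)
  then show ?thesis
    using SC assms(1) by (simp only: doubled_vector_even SC_iff_core_vector)
next
  case (DD k)
  then have "- z = 2 * int (t + 1 - k) - int t - 1" by (simp add: of_nat_diff)
  then show ?thesis
    using DD assms(2) by (simp only: doubled_vector_odd DD_iff_core_vector)
qed

text \<open>After halving, this position is at height \<open>s - 1\<close> on its runner, which
  turns the strict threshold into \<open>s \<le>\<close>. The offset \<open>- (t + 1)\<close>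
  matches the residues modulo \<open>2t + 2\<close> used for \<open>Delta_max\<close>.\<close>

lemma mem_doubled_beads_iff:
  assumes "is_core (t + 1) lam" "is_core (t + 1) \<mu>" "\<bar>z\<bar> \<le> int t"
  shows "z - int (t + 1) + 2 * int (t + 1) * s \<in> doubled_beads lam \<mu> \<longleftrightarrow> s \<le> doubled_vector t lam \<mu> z"
  using assms(3)
proof (cases rule: doubled_cases)
  case (SC k)
  have "z - int (t + 1) + 2 * int (t + 1) * s = 2 * (int k + int (t + 1) * (s - 1)) + 1"
    by (simp add: SC algebra_simps)
  moreover have "2 * x + 1 \<in> doubled_beads lam \<mu> \<longleftrightarrow> x \<in> beads lam" for x
    by (simp add: doubled_beads_def)
  ultimately show ?thesis
    using mem_beads_iff_core_vector[OF assms(1), of k "s - 1"] SC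
    by (simp only: doubled_vector_even) auto
next
  case (DD k)
  have "z - int (t + 1) + 2 * int (t + 1) * s = 2 * (int k + int (t + 1) * (s - 1))"
    by (simp add: DD algebra_simps)
  moreover have "2 * x \<in> doubled_beads lam \<mu> \<longleftrightarrow> x \<in> beads \<mu>" for x
    by (simp add: doubled_beads_def)
  ultimately show ?thesis
    using mem_beads_iff_core_vector[OF assms(2), of k "s - 1"] DD
    by (simp only: doubled_vector_odd) auto
qed

lemma comp_at_last_comps:
  assumes "1 \<le> i" "m \<le> length v"
  shows "comp_at (last_comps m v) i = v ! (length v - m + i - 1)"
  using assms by (simp add: comp_at_def last_comps_def)

lemma varphi_eq_doubled_vector:
  "varphi t (lam, \<mu>) = (\<lambda>j \<in> {1..t}. doubled_vector t lam \<mu> (int j))"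
proof -
  have 1: "comp_at (phi1 t lam) i = core_vector t lam ! (t + 1 - (t + 1) div 2 + i - 1)" if "1 \<le> i" for i
    unfolding phi1_def using that
    by (subst comp_at_last_comps) (auto simp: length_core_vector)
  have 2: "comp_at (phi2 t \<mu>) i = core_vector t \<mu> ! (t + 1 - t div 2 + i - 1)" if "1 \<le> i" for i
    unfolding phi2_def using that
    by (subst comp_at_last_comps) (auto simp: length_core_vector)
  have "(if odd (t + 1)
     then (if even j then comp_at (phi1 t lam) (j div 2) else comp_at (phi2 t \<mu>) ((j + 1) div 2))
     else (if even j then comp_at (phi2 t \<mu>) (j div 2) else comp_at (phi1 t lam) ((j + 1) div 2)))
     = doubled_vector t lam \<mu> (int j)" if "j \<in> {1..t}" for j
  proof -
    have e: "even (int t + int j) \<longleftrightarrow> (even t \<longleftrightarrow> even j)" by simp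
    have d1: "nat ((int t + int j) div 2) = (t + j) div 2"
      and d2: "nat ((int t + 1 + int j) div 2) = (t + 1 + j) div 2"
      by linarith+
    have "1 \<le> (j + 1) div 2" "even j \<Longrightarrow> 1 \<le> j div 2" using that by auto
    \<comment> \<open>In each parity case, the offset of the last components plus the halved index
      is \<open>(t + j) / 2\<close> for \<open>lam\<close> when \<open>j\<close> and
      \<open>t\<close> have equal parity, and \<open>(t + 1 + j) / 2\<close> for
      \<open>\<mu>\<close> otherwise.\<close>
    moreover have "t + 1 - (t + 1) div 2 + j div 2 - 1 = (t + j) div 2" if "even t" "even j" "1 \<le> j"
      using that by (auto elim!: evenE)
    moreover have "t + 1 - t div 2 + (j + 1) div 2 - 1 = (t + 1 + j) div 2" if "even t" "odd j"
      using that by (auto elim!: evenE oddE)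
    moreover have "t + 1 - t div 2 + j div 2 - 1 = (t + 1 + j) div 2" if "odd t" "even j" "1 \<le> j"
      using that by (auto elim!: evenE oddE)
    moreover have "t + 1 - (t + 1) div 2 + (j + 1) div 2 - 1 = (t + j) div 2" if "odd t" "odd j"
      using that by (auto elim!: oddE)
    ultimately show ?thesis
      using \<open>j \<in> {1..t}\<close> unfolding doubled_vector_def e d1 d2
      by (cases "even t"; cases "even j") (simp_all add: 1 2)
  qed
  then show ?thesis unfolding varphi_def by (auto intro!: restrict_ext)
qed

section \<open>The weight formula and the maxima of principal hook lengths\<close>

lemma doubled_weight:
  assumes "lam \<in> SC (t + 1)" "\<mu> \<in> DD (t + 1)"
  shows "int (weight lam + weight \<mu>) =
    (\<Sum>i = 1..t. int (t + 1) * (doubled_vector t lam \<mu> (int i))\<^sup>2 + int i * doubled_vector t lam \<mu> (int i))"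
proof -
  let ?N = "doubled_vector t lam \<mu>"
  define G where "G z = int (t + 1) * (?N z)\<^sup>2 + z * ?N z" for z
  have core: "is_core (t + 1) lam" "is_core (t + 1) \<mu>" and zero: "core_vector t \<mu> ! 0 = 0"
    using assms unfolding SC_iff_core_vector DD_iff_core_vector by blast+
  \<comment> \<open>The components of a core vector sum to 0, so any constant \<open>c\<close> may
    be subtracted from the coefficients \<open>2 k\<close>; \<open>t\<close> and
    \<open>t + 1\<close> recentre the two vectors.\<close>
  have shift: "2 * int (weight \<nu>) =
      (\<Sum>k<t + 1. int (t + 1) * (core_vector t \<nu> ! k)\<^sup>2 + (2 * int k - c) * core_vector t \<nu> ! k)"
    if "is_core (t + 1) \<nu>" for \<nu> c
  proof -
    have "(\<Sum>k<t + 1. int (t + 1) * (core_vector t \<nu> ! k)\<^sup>2 + (2 * int k - c) * core_vector t \<nu> ! k) =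
      int (t + 1) * (\<Sum>k<t + 1. (core_vector t \<nu> ! k)\<^sup>2) + 2 * (\<Sum>k<t + 1. int k * core_vector t \<nu> ! k)
      - c * (\<Sum>k<t + 1. core_vector t \<nu> ! k)"
      by (simp only: sum_distrib_left left_diff_distrib sum.distrib sum_subtractf mult.assoc add_diff_eq)
    then show ?thesis by (simp only: core_vector_sum[OF that] core_weight[OF that])
  qed
  have "2 * int (weight lam) = (\<Sum>k<t + 1. G (2 * int k - int t))"
    unfolding shift[OF core(1), of "int t"] G_def by (simp only: doubled_vector_even)
  also have "\<dots> = sum G {z \<in> {- int t..int t}. even (int t + z)}"
    by (rule sum.reindex_bij_witness[of _ "\<lambda>z. nat ((int t + z) div 2)" "\<lambda>k. 2 * int k - int t"])
      (auto elim!: evenE)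
  finally have lam: "2 * int (weight lam) = sum G {z \<in> {- int t..int t}. even (int t + z)}" .
  have "2 * int (weight \<mu>) = (\<Sum>k<t + 1. G (2 * int k - int t - 1))"
    unfolding shift[OF core(2), of "int t + 1"] G_def by (simp only: doubled_vector_odd diff_diff_eq[symmetric])
  also have "\<dots> = (\<Sum>k = 1..t. G (2 * int k - int t - 1))"
  proof (rule sum.mono_neutral_right)
    show "\<forall>k \<in> {..<t + 1} - {1..t}. G (2 * int k - int t - 1) = 0"
      unfolding G_def doubled_vector_odd using zero by (auto simp: not_le)
  qed auto
  also have "\<dots> = sum G {z \<in> {- int t..int t}. odd (int t + z)}"
    by (rule sum.reindex_bij_witness[of _ "\<lambda>z. nat ((int t + 1 + z) div 2)" "\<lambda>k. 2 * int k - int t - 1"])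
      (auto elim!: oddE)
  finally have mu: "2 * int (weight \<mu>) = sum G {z \<in> {- int t..int t}. odd (int t + z)}" .
  have "2 * int (weight lam + weight \<mu>) = sum G {- int t..int t}"
  proof -
    have "{- int t..int t} = {z \<in> {- int t..int t}. even (int t + z)} \<union> {z \<in> {- int t..int t}. odd (int t + z)}"
      by blast
    then have "sum G {- int t..int t} =
        sum G ({z \<in> {- int t..int t}. even (int t + z)} \<union> {z \<in> {- int t..int t}. odd (int t + z)})"
      by (simp only:)
    also have "\<dots> = sum G {z \<in> {- int t..int t}. even (int t + z)} + sum G {z \<in> {- int t..int t}. odd (int t + z)}"
      by (rule sum.union_disjoint) (auto intro!: finite_subset[of _ "{- int t..int t}"])
    finally show ?thesis using lam mu by simp
  qed
  \<comment> \<open>\<open>G\<close> is even and vanishes at 0, since the doubled vector is odd, so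
    the sum is twice its positive half.\<close>
  also have "\<dots> = sum G {- int t..- 1} + G 0 + sum G {1..int t}"
  proof -
    have "{- int t..int t} = {- int t..- 1} \<union> {0} \<union> {1..int t}" by auto
    then have "sum G {- int t..int t} = sum G ({- int t..- 1} \<union> {0} \<union> {1..int t})" by simp
    also have "\<dots> = sum G ({- int t..- 1} \<union> {0}) + sum G {1..int t}" by (rule sum.union_disjoint) auto
    also have "sum G ({- int t..- 1} \<union> {0}) = sum G {- int t..- 1} + G 0" by simp
    finally show ?thesis .
  qed
  also have "sum G {- int t..- 1} = sum G {1..int t}"
  proof (rule sum.reindex_bij_witness[of _ uminus uminus])
    fix z assume "z \<in> {- int t..- 1}"
    then show "G (- z) = G z" unfolding G_def by (subst (1 2) doubled_vector_minus[OF assms]) auto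
  qed auto
  also have "G 0 = 0" using doubled_vector_minus[OF assms, of 0] by (simp add: G_def)
  finally have "int (weight lam + weight \<mu>) = sum G {1..int t}" by simp
  also have "\<dots> = (\<Sum>i = 1..t. G (int i))"
    by (rule sum.reindex_bij_witness[of _ int nat]) auto
  finally show ?thesis by (simp only: G_def)
qed

text \<open>With \<open>P = t + 1\<close>, the principal hook lengths in the class of
  \<open>i - P\<close> are \<open>i - P + 2 P s\<close> for \<open>1 \<le> s \<le> n\<close>, and by
  oddness those in the class of \<open>- i - P\<close> are \<open>- i - P + 2 P s\<close> for
  \<open>1 \<le> s \<le> - n\<close>. At most one family is nonempty, according to the sign of
  \<open>n\<close>, and its last member is the maximum; \<open>n = 0\<close> leaves the default
  \<open>i - P\<close>.\<close>

lemma Delta_max_eq: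
  assumes lam: "lam \<in> SC (t + 1)" and mu: "\<mu> \<in> DD (t + 1)" and i: "i \<in> {1..t}"
  shows "int t + 1 + Delta_max t lam \<mu> i =
    (if doubled_vector t lam \<mu> (int i) \<ge> 0 then 1 else - 1) *
      ((2 * int t + 2) * doubled_vector t lam \<mu> (int i) + int i)"
proof -
  define n where "n = doubled_vector t lam \<mu> (int i)"
  define P where "P = int (t + 1)"
  have iP: "0 < int i" "int i < P" "0 < P" using i by (auto simp: P_def)
  define V where "V = (if n \<ge> 0 then int i - P + 2 * P * n else - int i - P + 2 * P * (- n))"
  define H where "H = {h \<in> Delta lam \<mu>. [h = int i - int t - 1] (mod (2 * int t + 2)) \<or>
                      [h = - int i - int t - 1] (mod (2 * int t + 2))} \<union> {int i - int t - 1}"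
  have core: "is_core (t + 1) lam" "is_core (t + 1) \<mu>"
    using lam mu by (auto simp: SC_def DD_def)
  have neg: "doubled_vector t lam \<mu> (- int i) = - n"
    using doubled_vector_minus[OF lam mu, of "int i"] i by (simp add: n_def)
  \<comment> \<open>Since the absolute value of \<open>z\<close> is less than \<open>P\<close>,
    positivity amounts to \<open>s \<ge> 1\<close>.\<close>
  have D: "z - P + 2 * P * s \<in> Delta lam \<mu> \<longleftrightarrow> 1 \<le> s \<and> s \<le> doubled_vector t lam \<mu> z" if "\<bar>z\<bar> = int i" for z s
  proof -
    have "0 < z - P + 2 * P * s \<longleftrightarrow> 1 \<le> s"
    proof
      assume "1 \<le> s"
      then have "2 * P * 1 \<le> 2 * P * s" using iP by (intro mult_left_mono) auto
      with iP that show "0 < z - P + 2 * P * s" by linarith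
    next
      assume *: "0 < z - P + 2 * P * s"
      show "1 \<le> s"
      proof (rule ccontr)
        assume "\<not> 1 \<le> s"
        then have "2 * P * s \<le> 2 * P * 0" using iP by (intro mult_left_mono) auto
        with iP that * show False by linarith
      qed
    qed
    then show ?thesis
      using mem_doubled_beads_iff[OF core, of z s] that i
      by (auto simp: Delta_eq_doubled_beads[OF lam mu] P_def)
  qed
  have cong: "[h = z - int t - 1] (mod (2 * int t + 2)) \<longleftrightarrow> (\<exists>s. h = z - P + 2 * P * s)" for h z
  proof -
    have "[h = z - int t - 1] (mod (2 * int t + 2)) \<longleftrightarrow> (\<exists>s. h = z - int t - 1 + (2 * int t + 2) * s)"
      by (metis cong_iff_lin cong_sym mult.commute)
    then show ?thesis by (simp add: P_def algebra_simps)
  qed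
  have H: "h \<in> H \<longleftrightarrow> (\<exists>s. 1 \<le> s \<and> s \<le> n \<and> h = int i - P + 2 * P * s) \<or>
      (\<exists>s. 1 \<le> s \<and> s \<le> - n \<and> h = - int i - P + 2 * P * s) \<or> h = int i - P" for h
  proof -
    have base: "int i - int t - 1 = int i - P" by (simp add: P_def)
    have H: "h \<in> H \<longleftrightarrow> (h \<in> Delta lam \<mu> \<and> [h = int i - int t - 1] (mod (2 * int t + 2))) \<or>
        (h \<in> Delta lam \<mu> \<and> [h = - int i - int t - 1] (mod (2 * int t + 2))) \<or> h = int i - int t - 1"
      unfolding H_def by blast
    have D': "int i - P + 2 * P * s \<in> Delta lam \<mu> \<longleftrightarrow> 1 \<le> s \<and> s \<le> n"
      and E': "- int i - P + 2 * P * s \<in> Delta lam \<mu> \<longleftrightarrow> 1 \<le> s \<and> s \<le> - n" for s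
      using D[of "int i" s] D[of "- int i" s] neg by (simp_all add: n_def)
    have "(h \<in> Delta lam \<mu> \<and> (\<exists>s. h = int i - P + 2 * P * s)) \<longleftrightarrow>
        (\<exists>s. 1 \<le> s \<and> s \<le> n \<and> h = int i - P + 2 * P * s)" using D' by metis
    moreover have "(h \<in> Delta lam \<mu> \<and> (\<exists>s. h = - int i - P + 2 * P * s)) \<longleftrightarrow>
        (\<exists>s. 1 \<le> s \<and> s \<le> - n \<and> h = - int i - P + 2 * P * s)" using E' by metis
    ultimately show ?thesis unfolding H cong unfolding base by (simp only:)
  qed
  have mono: "P * s \<le> P * s'" if "s \<le> s'" for s s' using that iP by simp
  have "V \<in> H"
  proof -
    consider "n = 0" | "1 \<le> n" | "1 \<le> - n" by linarith
    then show ?thesis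
    proof cases
      case 3
      then have "V = - int i - P + 2 * P * (- n)" by (simp add: V_def)
      with 3 show ?thesis unfolding H by blast
    qed (auto simp: H V_def)
  qed
  \<comment> \<open>The lower bound \<open>- P\<close> serves to make \<open>H\<close> finite. For
    negative \<open>n\<close> the default stays below \<open>V\<close> because
    \<open>i < P\<close>.\<close>
  moreover have bounds: "- P \<le> h \<and> h \<le> V" if h: "h \<in> H" for h
  proof -
    consider s where "1 \<le> s" "s \<le> n" "h = int i - P + 2 * P * s"
      | s where "1 \<le> s" "s \<le> - n" "h = - int i - P + 2 * P * s" | "h = int i - P"
      using h[unfolded H] by blast
    then show ?thesis
    proof cases
      case (1 s)
      moreover have "h \<le> V" using 1 mono[of s n] by (simp add: V_def)
      ultimately show ?thesis using mono[OF 1(1)] iP by linarith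
    next
      case (2 s)
      moreover have "h \<le> V" using 2 mono[of s "- n"] by (simp add: V_def)
      ultimately show ?thesis using mono[OF 2(1)] iP by linarith
    next
      case 3
      then show ?thesis using mono[of 0 n] mono[of 1 "- n"] iP by (auto simp: V_def)
    qed
  qed
  moreover have "finite H" by (rule finite_subset[of _ "{- P..V}"]) (use bounds in auto)
  ultimately have "Max H = V" by (intro Max_eqI) blast+
  then have "Delta_max t lam \<mu> i = V" unfolding Delta_max_def H_def .
  then show ?thesis by (simp add: V_def n_def[symmetric] P_def algebra_simps)
qed

section \<open>Bijectivity\<close>

text \<open>Oddness recovers the doubled vector on all of \<open>{- t..t}\<close> from its positive
  half, and with it both core vectors up to entry 0 of the second, which is 0.\<close>

lemma varphi_inj: "inj_on (varphi t) (SC (t + 1) \<times> DD (t + 1))"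
proof (rule inj_onI, clarify)
  fix lam \<mu> lam' \<mu>'
  assume in1: "lam \<in> SC (t + 1)" "\<mu> \<in> DD (t + 1)" and in2: "lam' \<in> SC (t + 1)" "\<mu>' \<in> DD (t + 1)"
    and eq: "varphi t (lam, \<mu>) = varphi t (lam', \<mu>')"
  let ?N = "doubled_vector t lam \<mu>" and ?N' = "doubled_vector t lam' \<mu>'"
  have pos: "?N (int j) = ?N' (int j)" if "j \<in> {1..t}" for j
    using fun_cong[OF eq, of j] that by (simp add: varphi_eq_doubled_vector)
  have same: "?N z = ?N' z" if z: "\<bar>z\<bar> \<le> int t" for z
  proof -
    consider "z = 0" | "0 < z" | "z < 0" by linarith
    then show ?thesis
    proof cases
      case 1
      then show ?thesis using doubled_vector_minus[OF in1 z] doubled_vector_minus[OF in2 z] by simp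
    next
      case 2
      then have "nat z \<in> {1..t}" using z by auto
      from pos[OF this] show ?thesis using 2 by simp
    next
      case 3
      then have "nat (- z) \<in> {1..t}" using z by auto
      from pos[OF this] show ?thesis
        using 3 doubled_vector_minus[OF in1 z] doubled_vector_minus[OF in2 z] by simp
    qed
  qed
  have "lam = lam'"
  proof (rule core_eqI[of t])
    fix k assume "k < t + 1"
    then show "core_vector t lam ! k = core_vector t lam' ! k"
      using same[of "2 * int k - int t"] by (simp add: doubled_vector_even)
  qed (use in1 in2 in \<open>auto simp: SC_def\<close>)
  moreover have "\<mu> = \<mu>'"
  proof (rule core_eqI[of t])
    fix k assume k: "k < t + 1"
    show "core_vector t \<mu> ! k = core_vector t \<mu>' ! k"
    proof (cases "k = 0")
      case True
      then show ?thesis using in1(2) in2(2) unfolding DD_iff_core_vector by metis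
    next
      case False
      then show ?thesis
        using k same[of "2 * int k - int t - 1"] by (simp add: doubled_vector_odd)
    qed
  qed (use in1 in2 in \<open>auto simp: DD_def\<close>)
  ultimately show "lam = lam' \<and> \<mu> = \<mu>'" by simp
qed

lemma varphi_surj:
  assumes "n \<in> {1..t} \<rightarrow>\<^sub>E (UNIV :: int set)"
  obtains lam \<mu> where "lam \<in> SC (t + 1)" "\<mu> \<in> DD (t + 1)" "varphi t (lam, \<mu>) = n"
proof -
  \<comment> \<open>The odd extension of \<open>n\<close>; as \<open>sgn 0 = 0\<close>, the
    unspecified value \<open>n 0\<close> has no influence.\<close>
  define s :: "int \<Rightarrow> int" where "s z = sgn z * n (nat \<bar>z\<bar>)" for z
  have s: "s (- z) = - s z" for z by (simp add: s_def)
  define m where "m k = s (2 * int k - int t)" for k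
  \<comment> \<open>Entry 0 is set by hand: the formula would read \<open>s (- t - 1)\<close> and so
    \<open>n (t + 1)\<close>, outside the domain of \<open>n\<close>.\<close>
  define m' where "m' k = (if k = 0 then 0 else s (2 * int k - int t - 1))" for k
  have m: "m (t - k) = - m k" if "k \<le> t" for k
  proof -
    have "2 * int (t - k) - int t = - (2 * int k - int t)" using that by (simp add: of_nat_diff)
    then show ?thesis unfolding m_def by (simp only: s)
  qed
  have m': "m' (t + 1 - k) = - m' k" if "k \<in> {1..t}" for k
  proof -
    have "2 * int (t + 1 - k) - int t - 1 = - (2 * int k - int t - 1)" using that by (simp add: of_nat_diff)
    moreover have "t + 1 - k \<noteq> 0" "k \<noteq> 0" using that by auto
    ultimately show ?thesis unfolding m'_def by (simp only: s if_False)
  qed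
  \<comment> \<open>Antisymmetry makes the sum equal to its own negative, which supplies the charge
    condition of \<open>core_vector_surj\<close>.\<close>
  have "(\<Sum>k<t + 1. m k) = (\<Sum>k<t + 1. - m k)"
    by (rule sum.reindex_bij_witness[of _ "\<lambda>k. t - k" "\<lambda>k. t - k"]) (auto simp: m)
  then have "(\<Sum>k<t + 1. m k) = 0" unfolding sum_negf by linarith
  then obtain lam where lam: "is_core (t + 1) lam" "\<And>k. k < t + 1 \<Longrightarrow> core_vector t lam ! k = m k"
    using core_vector_surj by blast
  have "(\<Sum>k = 1..t. m' k) = (\<Sum>k = 1..t. - m' k)"
    by (rule sum.reindex_bij_witness[of _ "\<lambda>k. t + 1 - k" "\<lambda>k. t + 1 - k"]) (auto simp: m'[simplified])
  then have "(\<Sum>k = 1..t. m' k) = 0" unfolding sum_negf by linarith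
  moreover have "(\<Sum>k<t + 1. m' k) = (\<Sum>k = 1..t. m' k)"
    by (rule sum.mono_neutral_right) (auto simp: m'_def not_le)
  ultimately have "(\<Sum>k<t + 1. m' k) = 0" by simp
  then obtain \<mu> where mu: "is_core (t + 1) \<mu>" "\<And>k. k < t + 1 \<Longrightarrow> core_vector t \<mu> ! k = m' k"
    using core_vector_surj by blast
  have "lam \<in> SC (t + 1)" using lam m unfolding SC_iff_core_vector by simp
  moreover have "\<mu> \<in> DD (t + 1)"
    unfolding DD_iff_core_vector
  proof (intro conjI ballI)
    show "core_vector t \<mu> ! 0 = 0" using mu(2)[of 0] by (simp add: m'_def)
    fix k assume k: "k \<in> {1..t}"
    then have "t + 1 - k < t + 1" "k < t + 1" by auto
    with mu(2) m'[OF k] show "core_vector t \<mu> ! (t + 1 - k) = - core_vector t \<mu> ! k" by metis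
  qed (fact mu(1))
  moreover have "varphi t (lam, \<mu>) = n"
  proof (rule PiE_ext[OF _ assms])
    show "varphi t (lam, \<mu>) \<in> {1..t} \<rightarrow>\<^sub>E UNIV" by (simp add: varphi_eq_doubled_vector)
    fix j assume j: "j \<in> {1..t}"
    then have "\<bar>int j\<bar> \<le> int t" by simp
    then have "doubled_vector t lam \<mu> (int j) = s (int j)"
    proof (cases rule: doubled_cases)
      case (SC k)
      then show ?thesis unfolding SC(2) doubled_vector_even using lam(2)[of k] by (simp add: m_def)
    next
      case (DD k)
      then show ?thesis unfolding DD(2) doubled_vector_odd using mu(2)[of k] by (simp add: m'_def)
    qed
    then show "varphi t (lam, \<mu>) j = n j" using j by (simp add: varphi_eq_doubled_vector s_def)
  qed
  ultimately show thesis by (rule that)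
qed

theorem theorem3p2:
  fixes t :: nat
  assumes "t \<ge> 2"
  shows "bij_betw (varphi t) (SC (t + 1) \<times> DD (t + 1)) ({1..t} \<rightarrow>\<^sub>E (UNIV :: int set)) \<and>
    (\<forall>lam \<in> SC (t + 1). \<forall>\<mu> \<in> DD (t + 1). \<forall>n. n = varphi t (lam, \<mu>) \<longrightarrow>
       real (weight lam + weight \<mu>) =
         (real t + 1) * (L2_set (\<lambda>i. real_of_int (n i)) {1..t})\<^sup>2
         + (\<Sum>i = 1..t. real i * real_of_int (n i)) \<and>
       (\<forall>i \<in> {1..t}. int t + 1 + Delta_max t lam \<mu> i =
          (if n i \<ge> 0 then 1 else -1) * ((2 * int t + 2) * n i + int i)))"
proof (intro conjI ballI allI impI)
  have "varphi t ` (SC (t + 1) \<times> DD (t + 1)) = {1..t} \<rightarrow>\<^sub>E (UNIV :: int set)"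
  proof (intro equalityI subsetI)
    fix n assume "n \<in> {1..t} \<rightarrow>\<^sub>E (UNIV :: int set)"
    then obtain lam \<mu> where "lam \<in> SC (t + 1)" "\<mu> \<in> DD (t + 1)" "varphi t (lam, \<mu>) = n"
      by (rule varphi_surj)
    then show "n \<in> varphi t ` (SC (t + 1) \<times> DD (t + 1))" by (metis SigmaI imageI)
  qed (auto simp: varphi_eq_doubled_vector)
  then show "bij_betw (varphi t) (SC (t + 1) \<times> DD (t + 1)) ({1..t} \<rightarrow>\<^sub>E (UNIV :: int set))"
    using varphi_inj by (simp only: bij_betw_def)
next
  fix lam \<mu> n i
  assume in1: "lam \<in> SC (t + 1)" "\<mu> \<in> DD (t + 1)" and n: "n = varphi t (lam, \<mu>)" and i: "i \<in> {1..t}"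
  show "int t + 1 + Delta_max t lam \<mu> i =
      (if n i \<ge> 0 then 1 else -1) * ((2 * int t + 2) * n i + int i)"
    using Delta_max_eq[OF in1 i] i by (simp add: n varphi_eq_doubled_vector)
next
  fix lam \<mu> n
  assume in1: "lam \<in> SC (t + 1)" "\<mu> \<in> DD (t + 1)" and n: "n = varphi t (lam, \<mu>)"
  have "int (weight lam + weight \<mu>) = (\<Sum>i = 1..t. int (t + 1) * (n i)\<^sup>2 + int i * n i)"
    unfolding doubled_weight[OF in1] n varphi_eq_doubled_vector by (intro sum.cong) simp_all
  then have "real_of_int (int (weight lam + weight \<mu>)) =
      real_of_int (\<Sum>i = 1..t. int (t + 1) * (n i)\<^sup>2 + int i * n i)" by (simp only:)
  also have "\<dots> = (real t + 1) * (\<Sum>i = 1..t. (real_of_int (n i))\<^sup>2) + (\<Sum>i = 1..t. real i * real_of_int (n i))"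
    by (simp add: sum.distrib sum_distrib_left algebra_simps)
  also have "(\<Sum>i = 1..t. (real_of_int (n i))\<^sup>2) = (L2_set (\<lambda>i. real_of_int (n i)) {1..t})\<^sup>2"
    by (simp add: L2_set_def sum_nonneg)
  finally show "real (weight lam + weight \<mu>) =
      (real t + 1) * (L2_set (\<lambda>i. real_of_int (n i)) {1..t})\<^sup>2 + (\<Sum>i = 1..t. real i * real_of_int (n i))"
    by simp
qed

end
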